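(* A rational map $R$ of degree two is a rational Ahlfors function if and only if it can be written as $$R(z)=\frac{a_1}{z-p_1}+\frac{a_2}{z-p_2}$$ for distinct $p_1,p_2\in\mathbb{C}$ and positive real numbers $a_1,a_2$ satisfying $a_1+a_2<|p_1-p_2|$.
   Context: $\widehat{\mathbb{C}}$ is the Riemann sphere and $\mathbb{D}=\{z\in\mathbb{C}:|z|<1\}$ is the open unit disk. For a rational map $R$, $R^{-1}(\mathbb{D})=\{z\in\widehat{\mathbb{C}}:|R(z)|<1\}$. Ahlfors function: let $X\subset\widehat{\mathbb{C}}$ be a domain containing $\infty$. For holomorphic $f:X\to\mathbb{C}$, put $f'(\infty):=\lim_{z\to\infty}z(f(z)-f(\infty))$. The Ahlfors function on $X$ is the unique function maximizing $\mathrm{Re}\,f'(\infty)$ among all holomorphic $f:X\to\mathbb{D}$ with $f(\infty)=0$. A rational map $R$ of degree $n$ is called $n$-good if $R(\infty)=0$, $R^{-1}(\mathbb{D})$ is connected, and $R^{-1}(\widehat{\mathbb{C}}\setminus\mathbb{D})$ has exactly $n$ connected components. A rational Ahlfors function (of degree $n$) is an $n$-good rational map $R$ whose restriction to $R^{-1}(\mathbb{D})$ is the Ahlfors function on $R^{-1}(\mathbb{D})$. *)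

theory Defs
  imports "HOL-Complex_Analysis.Complex_Analysis" "HOL-Computational_Algebra.Polynomial"
begin

text \<open>The Riemann sphere is the one-point compactification of the complex plane: a finite point
  \<open>z\<close> is \<open>Some z\<close>, and the point at infinity is \<open>None\<close>.\<close>

type_synonym csphere = "complex option"

definition riemann_sphere :: "csphere topology" where
  "riemann_sphere = Alexandroff_compactification euclidean"

text \<open>The coordinate \<open>1/z\<close> around infinity.\<close>

definition chart_inf :: "complex \<Rightarrow> csphere" where
  "chart_inf w = (if w = 0 then None else Some (1 / w))"

definition sphere_holomorphic_on :: "(csphere \<Rightarrow> complex) \<Rightarrow> csphere set \<Rightarrow> bool" where
  "sphere_holomorphic_on f X \<longleftrightarrow>
     (f \<circ> Some) holomorphic_on (Some -` X) \<and> (f \<circ> chart_inf) holomorphic_on (chart_inf -` X)"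

text \<open>At infinity, \<open>coeff p (degree q)\<close> is \<open>0\<close> if \<open>degree p < degree q\<close> and the leading
  coefficient of \<open>p\<close> if the degrees agree.  Meaningful only for coprime \<open>p\<close>, \<open>q\<close> with \<open>q \<noteq> 0\<close>.\<close>

fun quotient_map_of :: "complex poly \<Rightarrow> complex poly \<Rightarrow> csphere \<Rightarrow> csphere" where
  "quotient_map_of p q (Some z) = (if poly q z = 0 then None else Some (poly p z / poly q z))"
| "quotient_map_of p q None =
     (if degree p > degree q then None else Some (coeff p (degree q) / lead_coeff q))"

definition rational_map_of_degree :: "nat \<Rightarrow> (csphere \<Rightarrow> csphere) \<Rightarrow> bool" where
  "rational_map_of_degree n R \<longleftrightarrow>
     (\<exists>p q. q \<noteq> 0 \<and> coprime p q \<and> n = max (degree p) (degree q) \<and> R = quotient_map_of p q)"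

definition unit_disk :: "csphere set" where
  "unit_disk = Some ` ball 0 1"

definition n_good :: "nat \<Rightarrow> (csphere \<Rightarrow> csphere) \<Rightarrow> bool" where
  "n_good n R \<longleftrightarrow>
     rational_map_of_degree n R \<and> R None = Some 0 \<and>
     connectedin riemann_sphere (R -` unit_disk) \<and>
     finite (connected_components_of (subtopology riemann_sphere (R -` (- unit_disk)))) \<and>
     card (connected_components_of (subtopology riemann_sphere (R -` (- unit_disk)))) = n"

definition deriv_at_inf :: "(csphere \<Rightarrow> complex) \<Rightarrow> complex" where
  "deriv_at_inf f = Lim at_infinity (\<lambda>z. z * (f (Some z) - f None))"

definition Ahlfors_competitor :: "csphere set \<Rightarrow> (csphere \<Rightarrow> complex) \<Rightarrow> bool" where
  "Ahlfors_competitor X f \<longleftrightarrow> sphere_holomorphic_on f X \<and> f ` X \<subseteq> ball 0 1 \<and> f None = 0"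

definition Ahlfors_maximizer :: "csphere set \<Rightarrow> (csphere \<Rightarrow> complex) \<Rightarrow> bool" where
  "Ahlfors_maximizer X f \<longleftrightarrow>
     Ahlfors_competitor X f \<and>
     (\<forall>g. Ahlfors_competitor X g \<longrightarrow> Re (deriv_at_inf g) \<le> Re (deriv_at_inf f))"

text \<open>Functions on \<open>X\<close> are represented by total functions, so uniqueness is up to values
  outside \<open>X\<close>.\<close>

definition is_Ahlfors_function :: "csphere set \<Rightarrow> (csphere \<Rightarrow> complex) \<Rightarrow> bool" where
  "is_Ahlfors_function X f \<longleftrightarrow>
     openin riemann_sphere X \<and> connectedin riemann_sphere X \<and> None \<in> X \<and>
     Ahlfors_maximizer X f \<and>
     (\<forall>g. Ahlfors_maximizer X g \<longrightarrow> (\<forall>x\<in>X. g x = f x))"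

text \<open>On \<open>R -` unit_disk\<close> the map \<open>R\<close> takes finite values only, so there \<open>the \<circ> R\<close> is \<open>R\<close>
  regarded as a complex-valued function.\<close>

definition rational_Ahlfors_function :: "nat \<Rightarrow> (csphere \<Rightarrow> csphere) \<Rightarrow> bool" where
  "rational_Ahlfors_function n R \<longleftrightarrow>
     n_good n R \<and> is_Ahlfors_function (R -` unit_disk) (the \<circ> R)"

end

theory Submission
  imports Defs
begin

text \<open>In the coordinate \<open>t = (z - p2) / (z - p1)\<close> a map with two simple poles becomes
  \<open>W t = (1 - t) (A1 t + A2) / ((p2 - p1) t)\<close>, which is two-to-one with deck involution \<open>\<sigma>\<close> and critical
  values \<open>w1, w2\<close>. By the open mapping theorem every clopen part of the complement of \<open>R -` unit_disk\<close> covers the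
  complement of the disk, so \<open>R\<close> is 2-good iff both critical values lie in \<open>unit_disk\<close>.

  If the residues are positive, there is a weight \<open>h\<close> with \<open>h + h \<circ> \<sigma> = 1\<close> that is nonnegative on the
  boundary, equals \<open>1\<close> at infinity and vanishes doubly at the other zero of \<open>R\<close>. For a competitor \<open>g\<close> the
  trace \<open>h g + (h g) \<circ> \<sigma>\<close>, divided by \<open>W\<close>, is bounded by \<open>1\<close>, and its value at infinity is
  \<open>g'(\<infinity>) / R'(\<infinity>)\<close>. Conversely, extremality forces \<open>A1 + A2 > 0\<close> by rotating \<open>R\<close>, it forces \<open>A1 - A2\<close> to
  be real by a first-order variation, and comparing \<open>R\<close> with a Moebius transform of
  \<open>\<surd>((W - w1) (W - w2) / ((1 - cnj w1 W) (1 - cnj w2 W)))\<close>, whose derivative at infinity has modulus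
  \<open>\<bar>A1 - A2\<bar>\<close>, gives \<open>A1 A2 > 0\<close>.\<close>

subsection \<open>Topology of the Riemann sphere\<close>

text \<open>The coordinate \<open>t\<close> sends infinity to \<open>1\<close>, so \<open>X\<close>
  becomes a bounded open subset \<open>Y\<close> of the punctured plane and the derivative at
  infinity becomes a multiple of the derivative at \<open>1\<close>. Positivity enters through one
  number: \<open>h\<close> times \<open>h \<circ> \<sigma>\<close> equals
  \<open>\<mu> w\<^sup>2 / D w\<close> at \<open>w = W t\<close>, over the unit circle this is
  \<open>\<mu>\<close> divided by a positive number, and \<open>\<mu>\<close> is a nonnegative
  multiple of \<open>a1 a2\<close>. With sum \<open>1\<close> and product between 0 and 1/4 both
  weights lie between 0 and 1. The double zero of \<open>h\<close> removes from the trace at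
  infinity the value of \<open>g\<close> at the other zero of \<open>R\<close>, which nothing
  prescribes. Competitors need not extend to the boundary of \<open>Y\<close>; hence the maximum
  principle is used on smaller sublevel sets, and the sum of the norms of the two weights is
  expressed by a continuous function of \<open>W\<close>. In the converse the square root is
  single-valued on \<open>Y\<close>: its numerator is \<open>\<delta>\<close>, its denominator the
  branch \<open>r\<close> on the disk. Reality of \<open>A1 - A2\<close> is needed first, because
  only then does its Moebius transform have the simple derivative
  \<open>(A1 - A2) / d\<close>.\<close>

lemma clopen_image_eq_cball:
  fixes f :: "complex \<Rightarrow> complex"
  assumes holf: "f holomorphic_on S" and "open S"
    and nonconst: "\<And>X. open X \<Longrightarrow> X \<subseteq> S \<Longrightarrow> X \<noteq> {} \<Longrightarrow> \<not> f constant_on X"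
    and E: "E = {z \<in> S. norm (f z) \<le> \<rho>}" and "compact E"
    and oU: "openin (top_of_set E) U" and cU: "closedin (top_of_set E) U" and "U \<noteq> {}"
  shows "f ` U = cball 0 \<rho>"
proof -
  have UE: "U \<subseteq> E"
    using oU openin_imp_subset by blast
  have contU: "continuous_on U f"
    using UE E by (intro continuous_on_subset[OF holomorphic_on_imp_continuous_on[OF holf]]) auto
  have "compact U"
    using \<open>compact E\<close> cU closedin_compact by blast
  then have "closed (f ` U)"
    using compact_continuous_image contU compact_imp_closed by blast
  have sub: "f ` U \<subseteq> cball 0 \<rho>"
    using UE E by auto
  have cl: "closedin (top_of_set (cball 0 \<rho>)) (f ` U)"
    using sub \<open>closed (f ` U)\<close> by (simp add: closed_subset)
  obtain T where "open T" and T: "U = E \<inter> T"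
    using oU by (auto simp: openin_open)
  have "open (f ` (S \<inter> T))"
    by (rule open_mapping_thm2[OF holf \<open>open S\<close>]) (use \<open>open S\<close> \<open>open T\<close> nonconst in auto)
  \<comment> \<open>A point of \<open>S \<inter> T\<close> with value in the disk already lies in
    \<open>E \<inter> T\<close>, so the image of \<open>U\<close> is open in the disk as well as
    closed, and the disk is connected.\<close>
  moreover have "f ` U = cball 0 \<rho> \<inter> f ` (S \<inter> T)"
    unfolding T E by auto
  ultimately have "openin (top_of_set (cball 0 \<rho>)) (f ` U)"
    by (auto simp: openin_open)
  with cl show ?thesis
    using connected_cball[of "0::complex" \<rho>] \<open>U \<noteq> {}\<close> unfolding connected_clopen by blast
qed

section \<open>Plane sets inside the sphere\<close>

lemma topspace_riemann_sphere [simp]: "topspace riemann_sphere = UNIV"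
  by (auto simp: riemann_sphere_def UNIV_option_conv)

lemma homeomorphic_map_Some_riemann_sphere:
  "homeomorphic_map (top_of_set E) (subtopology riemann_sphere (Some ` E)) Some"
proof -
  have "homeomorphic_map euclidean (subtopology riemann_sphere (Some ` topspace euclidean)) (Some :: complex \<Rightarrow> _)"
    using embedding_map_Some unfolding embedding_map_def riemann_sphere_def by blast
  from homeomorphic_map_subtopologies[OF this, of E "Some ` E"] show ?thesis
    by (simp add: subtopology_subtopology Int_absorb1 Int_absorb2 image_mono)
qed

lemma connected_components_of_Some_image:
  "connected_components_of (subtopology riemann_sphere (Some ` E)) =
     (image Some) ` connected_components_of (top_of_set E)"
  by (rule homeomorphic_map_connected_components_of[OF homeomorphic_map_Some_riemann_sphere])

lemma bij_betw_components_Some_image: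
  "bij_betw (image Some) (connected_components_of (top_of_set E))
     (connected_components_of (subtopology riemann_sphere (Some ` E)))"
  unfolding connected_components_of_Some_image
  by (intro inj_on_imp_bij_betw inj_onI) (simp add: inj_image_eq_iff)

text \<open>A connected subset of the union that meets one of two disjoint closed sets misses the
  other.\<close>

lemma connected_components_of_Un_disjoint:
  fixes A B :: "'a::t2_space set"
  assumes A: "compact A" "connected A" "A \<noteq> {}" and B: "compact B" "connected B" "B \<noteq> {}"
    and "A \<inter> B = {}"
  shows "connected_components_of (top_of_set (A \<union> B)) = {A, B}"
proof -
  have *: "connected_component_of_set (top_of_set (A \<union> B)) x = A"
    if A: "compact A" "connected A" and B: "compact B" and "A \<inter> B = {}" and "x \<in> A" for A B :: "'a set" and x
  proof (rule connected_component_of_unique)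
    show "connectedin (top_of_set (A \<union> B)) A"
      using A by (simp add: connectedin_subtopology)
    fix C assume C: "x \<in> C \<and> connectedin (top_of_set (A \<union> B)) C"
    then have "connected C" "C \<subseteq> A \<union> B"
      by (auto simp: connectedin_subtopology)
    moreover have "A \<inter> C \<noteq> {}"
      using \<open>x \<in> A\<close> C by auto
    ultimately have "B \<inter> C = {}"
      using connected_closedD[of C A B] A B \<open>A \<inter> B = {}\<close> compact_imp_closed by auto
    with \<open>C \<subseteq> A \<union> B\<close> show "C \<subseteq> A" by auto
  qed (use \<open>x \<in> A\<close> in auto)
  have "connected_component_of_set (top_of_set (A \<union> B)) ` A = {A}"
    using *[of A B] assms by auto
  moreover have "connected_component_of_set (top_of_set (A \<union> B)) ` B = {B}"
    using *[of B A] assms by (auto simp: Un_commute Int_commute)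
  ultimately show ?thesis
    unfolding connected_components_of_def by (simp add: image_Un insert_commute)
qed

lemma openin_riemann_sphere_Compl_Some:
  assumes "compact E"
  shows "openin riemann_sphere (- Some ` E)"
proof -
  have "- Some ` E = insert None (Some ` (UNIV - E))"
  proof (rule set_eqI)
    show "x \<in> - Some ` E \<longleftrightarrow> x \<in> insert None (Some ` (UNIV - E))" for x :: csphere
      by (cases x) auto
  qed
  with assms show ?thesis
    by (auto simp: riemann_sphere_def openin_Alexandroff_compactification compact_imp_closed)
qed

text \<open>The set lies between the copy of \<open>- E\<close> and its closure: a neighbourhood of
  \<open>None\<close> omits only a compact set, whose union with \<open>E\<close> is compact and so
  cannot be the whole plane.\<close>

lemma connectedin_riemann_sphere_Compl_Some:
  assumes "compact E" and "connected (- E)"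
  shows "connectedin riemann_sphere (- Some ` E)"
proof (rule connectedin_intermediate_closure_of)
  show "connectedin riemann_sphere (Some ` (- E))"
    using \<open>connected (- E)\<close> continuous_map_Some[of "euclidean :: complex topology"]
    by (metis connectedin_continuous_map_image connectedin_iff_connected riemann_sphere_def)
  show "Some ` (- E) \<subseteq> - Some ` E"
    by auto
  have "\<exists>y. y \<in> Some ` (- E) \<and> y \<in> T" if "None \<in> T" and T: "openin riemann_sphere T" for T
  proof -
    obtain C where C: "compact C" "T = insert None (Some ` (UNIV - C))"
      using T \<open>None \<in> T\<close>
      unfolding riemann_sphere_def openin_Alexandroff_compactification by auto
    have "compact (C \<union> E)"
      using C \<open>compact E\<close> by blast
    then have "C \<union> E \<noteq> UNIV"
      using not_compact_UNIV by metis
    with C show ?thesis by blast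
  qed
  then have "None \<in> riemann_sphere closure_of (Some ` (- E))"
    by (simp add: in_closure_of)
  moreover have "Some ` (- E) \<subseteq> riemann_sphere closure_of (Some ` (- E))"
    by (rule closure_of_subset) simp
  moreover have "x = None \<or> x \<in> Some ` (- E)" if "x \<in> - Some ` E" for x :: csphere
    using that by (cases x) auto
  ultimately show "- Some ` E \<subseteq> riemann_sphere closure_of (Some ` (- E))"
    by blast
qed

subsection \<open>Two-to-one maps in the coordinate \<open>t\<close>\<close>

text \<open>\<open>w1\<close> and \<open>w2\<close> are the critical values of \<open>W\<close>.
  Their sum and product are prescribed so that no root of \<open>- A1 * A2\<close> has to be
  chosen.\<close>

locale degree_two =
  fixes A1 A2 d w1 w2 :: complex
  assumes A1 [simp]: "A1 \<noteq> 0" and A2 [simp]: "A2 \<noteq> 0" and d [simp]: "d \<noteq> 0"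
    and w_sum: "w1 + w2 = 2 * (A1 - A2) / d"
    and w_prod: "w1 * w2 = ((A1 + A2) / d)\<^sup>2"
    and w1_less: "norm w1 < 1" and w2_less: "norm w2 < 1"
begin

definition W :: "complex \<Rightarrow> complex" where
  "W t = (1 - t) * (A1 * t + A2) / (d * t)"

text \<open>This is \<open>- t\<close> times the derivative of \<open>W\<close>. It is odd under
  \<open>\<sigma>\<close> and squares to \<open>(W - w1) (W - w2)\<close>, so it is a single-valued
  root on the two-sheeted cover.\<close>

definition \<delta> :: "complex \<Rightarrow> complex" where
  "\<delta> t = (A2 / t + A1 * t) / d"

definition \<sigma> :: "complex \<Rightarrow> complex" where
  "\<sigma> t = - A2 / (A1 * t)"

definition Y :: "complex set" where
  "Y = {t. t \<noteq> 0 \<and> norm (W t) < 1}"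

definition sublevel :: "real \<Rightarrow> complex set" where
  "sublevel \<rho> = {t. t \<noteq> 0 \<and> norm (W t) \<le> \<rho>}"

text \<open>A branch of \<open>sqrt ((1 - cnj w1 w) (1 - cnj w2 w))\<close> on the closed disk.\<close>

definition r :: "complex \<Rightarrow> complex" where
  "r w = csqrt (1 - cnj w1 * w) * csqrt (1 - cnj w2 * w)"

section \<open>Algebra of the map and its involution\<close>

lemma W_1 [simp]: "W 1 = 0"
  by (simp add: W_def)

lemma \<delta>_1: "\<delta> 1 = (A1 + A2) / d"
  by (simp add: \<delta>_def add.commute)

lemma one_in_Y [simp]: "1 \<in> Y"
  by (simp add: Y_def)

lemma \<sigma>_nonzero: "t \<noteq> 0 \<Longrightarrow> \<sigma> t \<noteq> 0"
  by (simp add: \<sigma>_def)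

lemma \<sigma>_\<sigma>: "t \<noteq> 0 \<Longrightarrow> \<sigma> (\<sigma> t) = t"
  by (simp add: \<sigma>_def)

lemma W_\<sigma>: "t \<noteq> 0 \<Longrightarrow> W (\<sigma> t) = W t"
  by (simp add: W_def \<sigma>_def divide_simps) (simp add: algebra_simps)

lemma \<delta>_\<sigma>: "t \<noteq> 0 \<Longrightarrow> \<delta> (\<sigma> t) = - \<delta> t"
  by (simp add: \<delta>_def \<sigma>_def field_simps)

lemma \<sigma>_in_Y: "t \<in> Y \<Longrightarrow> \<sigma> t \<in> Y"
  by (simp add: Y_def W_\<sigma> \<sigma>_nonzero)

lemma W_minus_\<delta>: "t \<noteq> 0 \<Longrightarrow> W t - \<delta> t = (A1 - A2 - 2 * A1 * t) / d"
  by (simp add: W_def \<delta>_def divide_simps) (simp add: algebra_simps)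

lemma \<delta>_square: 
  assumes "t \<noteq> 0"
  shows "(\<delta> t)\<^sup>2 = (W t - w1) * (W t - w2)"
proof -
  have "(\<delta> t)\<^sup>2 = (W t)\<^sup>2 - 2 * (A1 - A2) / d * W t + ((A1 + A2) / d)\<^sup>2"
    using assms by (simp add: W_def \<delta>_def divide_simps) algebra
  also have "\<dots> = (W t - w1) * (W t - w2)"
    unfolding w_sum[symmetric] w_prod[symmetric] by (simp add: power2_eq_square algebra_simps)
  finally show ?thesis .
qed

lemma holomorphic_W: "W holomorphic_on - {0}"
  unfolding W_def by (intro holomorphic_intros) auto

lemma holomorphic_\<delta>: "\<delta> holomorphic_on - {0}"
  unfolding \<delta>_def by (intro holomorphic_intros) auto

lemma holomorphic_\<sigma>: "\<sigma> holomorphic_on - {0}"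
  unfolding \<sigma>_def by (intro holomorphic_intros) auto

lemma W_has_field_derivative:
  assumes "t \<noteq> 0"
  shows "(W has_field_derivative - \<delta> t / t) (at t)"
proof -
  have "((\<lambda>t. (A1 - A2 + A2 / t - A1 * t) / d) has_field_derivative (- A2 / (t * t) - A1) / d) (at t)"
    using assms by (auto intro!: derivative_eq_intros)
  moreover have "(- A2 / (t * t) - A1) / d = - \<delta> t / t"
    using assms by (simp add: \<delta>_def field_simps)
  ultimately have "((\<lambda>t. (A1 - A2 + A2 / t - A1 * t) / d) has_field_derivative - \<delta> t / t) (at t)"
    by simp
  then show ?thesis
    by (rule has_field_derivative_transform_within_open[of _ _ _ "- {0}"])
       (use assms in \<open>auto simp: W_def field_simps\<close>)
qed

lemma \<delta>_has_field_derivative: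
  assumes "t \<noteq> 0"
  shows "(\<delta> has_field_derivative (A1 - A2 / t\<^sup>2) / d) (at t)"
  unfolding \<delta>_def using assms by (auto intro!: derivative_eq_intros simp: power2_eq_square)

text \<open>Over a critical value \<open>\<delta>\<close> vanishes, and \<open>W - \<delta>\<close>
  is an injective affine function of \<open>t\<close>.\<close>

lemma critical_point_unique:
  assumes "t \<noteq> 0" "t' \<noteq> 0" "W t = w1" "W t' = w1"
  shows "t = t'"
proof -
  have "\<delta> t = 0" "\<delta> t' = 0"
    using \<delta>_square[of t] \<delta>_square[of t'] assms by auto
  then have "(A1 - A2 - 2 * A1 * t) / d = (A1 - A2 - 2 * A1 * t') / d"
    using W_minus_\<delta>[of t] W_minus_\<delta>[of t'] assms by simp
  then show ?thesis by simp
qed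

lemma continuous_on_W: "0 \<notin> S \<Longrightarrow> continuous_on S W"
  by (rule continuous_on_subset[OF holomorphic_on_imp_continuous_on[OF holomorphic_W]]) auto

lemma continuous_on_\<delta>: "0 \<notin> S \<Longrightarrow> continuous_on S \<delta>"
  by (rule continuous_on_subset[OF holomorphic_on_imp_continuous_on[OF holomorphic_\<delta>]]) auto

section \<open>Sublevel sets and connectedness\<close>

lemma open_Y: "open Y"
proof -
  have "open ((- {0}) \<inter> W -` ball 0 1)"
    by (rule continuous_open_preimage) (auto intro: continuous_on_W)
  moreover have "Y = (- {0}) \<inter> W -` ball 0 1"
    by (auto simp: Y_def)
  ultimately show ?thesis by simp
qed

lemma closed_sublevel: "closed (sublevel \<rho>)"
proof -
  \<comment> \<open>The cleared inequality excludes \<open>t = 0\<close> on its own: its left side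
    is then \<open>norm A2\<close> and its right side \<open>0\<close>.\<close>
  have "sublevel \<rho> = {t. norm ((1 - t) * (A1 * t + A2)) \<le> \<rho> * norm (d * t)}"
    by (auto simp: sublevel_def W_def norm_divide divide_simps)
  moreover have "closed \<dots>"
    by (intro closed_Collect_le continuous_intros)
  ultimately show ?thesis by simp
qed

text \<open>A bound on \<open>W\<close> bounds \<open>\<delta>\<^sup>2\<close>, hence
  \<open>\<delta>\<close>, and \<open>W - \<delta>\<close> is affine in \<open>t\<close> with
  nonzero slope.\<close>

lemma bounded_sublevel: "bounded (sublevel \<rho>)"
proof -
  define C where "C = sqrt ((\<bar>\<rho>\<bar> + 1) * (\<bar>\<rho>\<bar> + 1))"
  have "norm t \<le> (norm (A1 - A2) + norm d * (\<bar>\<rho>\<bar> + C)) / norm (2 * A1)" if "t \<in> sublevel \<rho>" for t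
  proof -
    have t: "t \<noteq> 0" "norm (W t) \<le> \<bar>\<rho>\<bar>"
      using that by (auto simp: sublevel_def)
    have "(norm (\<delta> t))\<^sup>2 = norm (W t - w1) * norm (W t - w2)"
      using \<delta>_square[OF t(1)] by (metis norm_mult norm_power)
    also have "\<dots> \<le> (\<bar>\<rho>\<bar> + 1) * (\<bar>\<rho>\<bar> + 1)"
      using norm_triangle_ineq4[of "W t" w1] norm_triangle_ineq4[of "W t" w2] t w1_less w2_less
      by (intro mult_mono) auto
    finally have "norm (\<delta> t) \<le> C"
      unfolding C_def using real_le_rsqrt by blast
    then have "norm (W t - \<delta> t) \<le> \<bar>\<rho>\<bar> + C"
      using norm_triangle_ineq4[of "W t" "\<delta> t"] t by linarith
    moreover have "2 * A1 * t = (A1 - A2) - d * (W t - \<delta> t)"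
      using W_minus_\<delta>[OF t(1)] by (simp add: field_simps)
    moreover have "norm (d * (W t - \<delta> t)) \<le> norm d * (\<bar>\<rho>\<bar> + C)"
      using calculation(1) by (simp add: norm_mult mult_left_mono)
    ultimately have "norm (2 * A1 * t) \<le> norm (A1 - A2) + norm d * (\<bar>\<rho>\<bar> + C)"
      by (metis add_left_mono norm_triangle_ineq4 order_trans)
    then show ?thesis
      by (simp add: norm_mult field_simps)
  qed
  then show ?thesis
    by (auto simp: bounded_iff)
qed

lemma compact_sublevel: "compact (sublevel \<rho>)"
  by (simp add: compact_eq_bounded_closed bounded_sublevel closed_sublevel)

lemma zero_notin_sublevel [simp]: "0 \<notin> sublevel \<rho>"
  by (simp add: sublevel_def)

lemma Y_subset_sublevel: "Y \<subseteq> sublevel 1"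
  by (auto simp: Y_def sublevel_def)

lemma closure_Y_subset: "closure Y \<subseteq> sublevel 1"
  by (rule closure_minimal[OF Y_subset_sublevel closed_sublevel])

lemma bounded_Y: "bounded Y"
  by (rule bounded_subset[OF bounded_sublevel Y_subset_sublevel])

lemma frontier_Y: "t \<in> frontier Y \<Longrightarrow> t \<noteq> 0 \<and> norm (W t) = 1"
  using closure_Y_subset open_Y by (auto simp: frontier_def interior_open Y_def sublevel_def)

lemma W_nonconst:
  assumes "open X" "X \<subseteq> - {0}" "X \<noteq> {}"
  shows "\<not> W constant_on X"
proof
  assume "W constant_on X"
  then obtain c where c: "\<And>t. t \<in> X \<Longrightarrow> W t = c"
    by (auto simp: constant_on_def)
  have "\<delta> t = 0" if "t \<in> X" for t
  proof -
    have "((\<lambda>_. c) has_field_derivative - \<delta> t / t) (at t)"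
      by (rule has_field_derivative_transform_within_open[OF W_has_field_derivative \<open>open X\<close> that])
         (use c assms that in auto)
    then have "- \<delta> t / t = 0"
      using DERIV_unique DERIV_const by blast
    then show ?thesis using assms that by auto
  qed
  then have "t = (A1 - A2 - c * d) / (2 * A1)" if "t \<in> X" for t
    using W_minus_\<delta>[of t] c[OF that] assms that by (auto simp: field_simps)
  then have "X \<subseteq> {(A1 - A2 - c * d) / (2 * A1)}" by blast
  then have "finite X" using finite_subset by blast
  then show False
    using \<open>open X\<close> \<open>X \<noteq> {}\<close> using finite_imp_not_open by blast
qed

text \<open>Every nonempty clopen part covers the disk of radius \<open>\<rho>\<close> and so
  contains a preimage of \<open>w1\<close>. That preimage is unique, so two complementary parts
  cannot both be nonempty.\<close>

lemma connected_sublevel: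
  assumes "norm w1 \<le> \<rho>" "0 \<le> \<rho>"
  shows "connected (sublevel \<rho>)"
  unfolding connected_clopen
proof (intro allI impI, elim conjE)
  fix T assume o: "openin (top_of_set (sublevel \<rho>)) T" and c: "closedin (top_of_set (sublevel \<rho>)) T"
  have T: "T \<subseteq> sublevel \<rho>" using o openin_imp_subset by blast
  have *: "\<exists>t\<in>U. W t = w1"
    if "openin (top_of_set (sublevel \<rho>)) U" "closedin (top_of_set (sublevel \<rho>)) U" "U \<noteq> {}" for U
  proof -
    have "W ` U = cball 0 \<rho>"
      by (rule clopen_image_eq_cball[OF holomorphic_W _ W_nonconst _ compact_sublevel that])
         (auto simp: sublevel_def)
    then have "w1 \<in> W ` U" using assms by simp
    then show ?thesis by force
  qed
  show "T = {} \<or> T = sublevel \<rho>"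
  proof (rule ccontr)
    assume n: "\<not> ?thesis"
    define V where "V = sublevel \<rho> - T"
    have "openin (top_of_set (sublevel \<rho>)) V" "closedin (top_of_set (sublevel \<rho>)) V" "V \<noteq> {}"
      using o c n T openin_diff[OF openin_subtopology_self c] closedin_diff[OF closedin_subtopology_refl[THEN iffD2] o] unfolding V_def by auto
    then obtain t' where t': "t' \<in> V" "W t' = w1" using * by blast
    obtain t where "t \<in> T" "W t = w1" using * o c n by blast
    then have "t = t'"
      using critical_point_unique[of t t'] t' T unfolding V_def sublevel_def by blast
    then show False using \<open>t \<in> T\<close> t' unfolding V_def by blast
  qed
qed

text \<open>\<open>Y\<close> is exhausted by the sublevel sets of radius at least
  \<open>norm w1\<close>, which are connected and share the zero \<open>1\<close> of
  \<open>W\<close>.\<close>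

lemma connected_Y: "connected Y"
proof -
  have "Y = \<Union> (sublevel ` {norm w1..<1})"
  proof (intro equalityI subsetI)
    fix t assume "t \<in> Y"
    then have "t \<in> sublevel (max (norm w1) (norm (W t)))" "max (norm w1) (norm (W t)) \<in> {norm w1..<1}"
      using w1_less by (auto simp: Y_def sublevel_def)
    then show "t \<in> \<Union> (sublevel ` {norm w1..<1})" by blast
  qed (auto simp: Y_def sublevel_def)
  moreover have "connected (\<Union> (sublevel ` {norm w1..<1}))"
  proof (rule connected_Union)
    have "0 \<le> \<rho>" if "norm w1 \<le> \<rho>" for \<rho>
      using that norm_ge_zero order_trans by blast
    then show "connected S" if "S \<in> sublevel ` {norm w1..<1}" for S
      using that connected_sublevel by auto
    have "1 \<in> \<Inter> (sublevel ` {norm w1..<1})"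
      using \<open>\<And>\<rho>. norm w1 \<le> \<rho> \<Longrightarrow> 0 \<le> \<rho>\<close> by (auto simp: sublevel_def)
    then show "\<Inter> (sublevel ` {norm w1..<1}) \<noteq> {}" by blast
  qed
  ultimately show ?thesis by simp
qed

section \<open>The branch \<open>r\<close> and bounds on the closed disk\<close>

lemma Re_one_minus_pos: "norm u < 1 \<Longrightarrow> norm w \<le> 1 \<Longrightarrow> 0 < Re (1 - cnj u * w)"
proof -
  assume "norm u < 1" "norm w \<le> 1"
  then have "norm (cnj u * w) < 1"
    by (smt (verit, best) complex_mod_cnj mult_left_le norm_ge_zero norm_mult)
  then show ?thesis
    using complex_Re_le_cmod[of "cnj u * w"] by simp
qed

lemma r_holomorphic: "r holomorphic_on {w. norm w < 1}"
proof -
  have "1 - cnj w1 * w \<notin> \<real>\<^sub>\<le>\<^sub>0" "1 - cnj w2 * w \<notin> \<real>\<^sub>\<le>\<^sub>0" if "norm w < 1" for w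
    using Re_one_minus_pos[OF w1_less, of w] Re_one_minus_pos[OF w2_less, of w] that
    by (auto simp: complex_nonpos_Reals_iff)
  then show ?thesis
    unfolding r_def by (intro holomorphic_intros) auto
qed

lemma r_continuous: "continuous_on {w. norm w \<le> 1} r"
proof -
  have "1 - cnj w1 * w \<notin> \<real>\<^sub>\<le>\<^sub>0" "1 - cnj w2 * w \<notin> \<real>\<^sub>\<le>\<^sub>0" if "norm w \<le> 1" for w
    using Re_one_minus_pos[OF w1_less, of w] Re_one_minus_pos[OF w2_less, of w] that
    by (auto simp: complex_nonpos_Reals_iff)
  then show ?thesis
    unfolding r_def
    by (intro continuous_intros continuous_on_compose2[of "- \<real>\<^sub>\<le>\<^sub>0" csqrt] continuous_on_csqrt) auto
qed

lemma r_square: "(r w)\<^sup>2 = (1 - cnj w1 * w) * (1 - cnj w2 * w)"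
  by (simp add: r_def power_mult_distrib)

lemma r_nonzero: "norm w \<le> 1 \<Longrightarrow> r w \<noteq> 0"
  using Re_one_minus_pos[OF w1_less, of w] Re_one_minus_pos[OF w2_less, of w]
  by (auto simp: r_def simp del: minus_complex.simps times_complex.simps)

lemma r_0 [simp]: "r 0 = 1"
  by (simp add: r_def)

lemma holomorphic_W_Y: "W holomorphic_on Y"
  by (rule holomorphic_on_subset[OF holomorphic_W]) (auto simp: Y_def)

lemma holomorphic_\<delta>_Y: "\<delta> holomorphic_on Y"
  by (rule holomorphic_on_subset[OF holomorphic_\<delta>]) (auto simp: Y_def)

lemma holomorphic_r_W: "(\<lambda>t. r (W t)) holomorphic_on Y"
  using holomorphic_on_compose_gen[OF holomorphic_W_Y r_holomorphic] by (auto simp: o_def Y_def)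

lemma norm_\<delta>_le:
  assumes "t \<noteq> 0" "norm (W t) \<le> 1"
  shows "norm (\<delta> t) \<le> 2"
proof -
  have "(norm (\<delta> t))\<^sup>2 = norm (W t - w1) * norm (W t - w2)"
    using \<delta>_square[OF assms(1)] by (metis norm_mult norm_power)
  also have "\<dots> \<le> 2\<^sup>2"
    unfolding power2_eq_square
    using norm_triangle_ineq4[of "W t" w1] norm_triangle_ineq4[of "W t" w2] assms w1_less w2_less
    by (intro mult_mono) auto
  finally show ?thesis
    by (rule power2_le_imp_le) simp
qed

lemma norm_r_le:
  assumes "norm w \<le> 1"
  shows "norm (r w) \<le> 2"
proof -
  have le: "norm (1 - cnj u * w) \<le> 2" if "norm u < 1" for u
  proof -
    have "norm (cnj u * w) \<le> 1"
      using that assms by (simp add: norm_mult mult_le_one)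
    then show ?thesis using norm_triangle_ineq4[of 1 "cnj u * w"] by simp
  qed
  have "(norm (r w))\<^sup>2 = norm (1 - cnj w1 * w) * norm (1 - cnj w2 * w)"
    by (metis norm_mult norm_power r_square)
  also have "\<dots> \<le> 2\<^sup>2"
    unfolding power2_eq_square
    using le[OF w1_less] le[OF w2_less] by (intro mult_mono) auto
  finally show ?thesis
    by (rule power2_le_imp_le) simp
qed

end

subsection \<open>Positive residues imply extremality\<close>

context degree_two
begin

text \<open>\<open>F\<close> need not extend to the boundary of \<open>Y\<close>, so the maximum
  principle is applied on \<open>norm (W t) < \<rho>\<close> with \<open>\<rho>\<close> close to
  \<open>1\<close>, whose closure stays inside \<open>Y\<close>. The slack \<open>\<epsilon>\<close>
  allows boundary estimates that hold only in the limit.\<close>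

lemma norm_bound_from_frontier:
  assumes hol: "F holomorphic_on Y"
    and bound: "\<And>\<epsilon>. 0 < \<epsilon> \<Longrightarrow> \<exists>\<rho>0<1. \<forall>t\<in>Y. \<rho>0 \<le> norm (W t) \<longrightarrow> norm (F t) \<le> B + \<epsilon>"
    and "t \<in> Y"
  shows "norm (F t) \<le> B"
proof (rule field_le_epsilon)
  fix \<epsilon> :: real assume "0 < \<epsilon>"
  then obtain \<rho>0 where \<rho>0: "\<rho>0 < 1" "\<And>t. t \<in> Y \<Longrightarrow> \<rho>0 \<le> norm (W t) \<Longrightarrow> norm (F t) \<le> B + \<epsilon>"
    using bound by blast
  obtain \<rho> where \<rho>: "max \<rho>0 (norm (W t)) < \<rho>" "\<rho> < 1"
    using \<rho>0(1) \<open>t \<in> Y\<close> dense[of "max \<rho>0 (norm (W t))" 1] by (auto simp: Y_def)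
  define S where "S = {t. t \<noteq> 0 \<and> norm (W t) < \<rho>}"
  have "open ((- {0}) \<inter> W -` ball 0 \<rho>)"
    by (rule continuous_open_preimage) (auto intro: continuous_on_W)
  moreover have "S = (- {0}) \<inter> W -` ball 0 \<rho>"
    by (auto simp: S_def)
  ultimately have "open S" by simp
  have sub: "S \<subseteq> sublevel \<rho>" by (auto simp: S_def sublevel_def)
  have cl: "closure S \<subseteq> sublevel \<rho>"
    by (rule closure_minimal[OF sub closed_sublevel])
  have clY: "sublevel \<rho> \<subseteq> Y" using \<rho> by (auto simp: sublevel_def Y_def)
  have "t \<in> S" using \<rho> \<open>t \<in> Y\<close> by (auto simp: S_def Y_def)
  then show "norm (F t) \<le> B + \<epsilon>"
  proof (rule maximum_modulus_frontier[rotated 4])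
    show "F holomorphic_on interior S"
      using sub clY by (intro holomorphic_on_subset[OF hol]) (auto dest: interior_subset[THEN subsetD])
    show "continuous_on (closure S) F"
      using cl clY by (intro continuous_on_subset[OF holomorphic_on_imp_continuous_on[OF hol]]) auto
    show "bounded S" by (rule bounded_subset[OF bounded_sublevel sub])
    fix z assume "z \<in> frontier S"
    then have "z \<in> sublevel \<rho>" "z \<notin> S"
      using cl \<open>open S\<close> by (auto simp: frontier_def interior_open)
    then have "z \<in> Y" "norm (W z) = \<rho>"
      using clY by (auto simp: S_def sublevel_def)
    then show "norm (F z) \<le> B + \<epsilon>" using \<rho>0(2) \<rho> by auto
  qed
qed

end

locale degree_two_positive = degree_two "complex_of_real a1" "complex_of_real a2" d w1 w2
  for a1 a2 :: real and d w1 w2 :: complex +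
  assumes a1_pos: "0 < a1" and a2_pos: "0 < a2"
begin

text \<open>The odd part \<open>k\<close> of the weight \<open>h = 1/2 + k\<close> satisfies \<open>k\<^sup>2 = K \<circ> W\<close>. The constants \<open>\<mu>\<close>, \<open>\<nu>\<close> are chosen
  such that \<open>1/4 - K\<close> has double zeros at \<open>0\<close> and at infinity while \<open>K\<close> is the square \<open>P\<^sup>2 / (4 D)\<close>, which
  makes \<open>k\<close> single-valued.\<close>

definition \<nu> :: real where
  "\<nu> = - (a1 - a2) / (a1 + a2) * (1 + ((a1 + a2) / norm d)\<^sup>2)"

definition \<mu> :: real where
  "\<mu> = (1 - ((a1 + a2) / norm d)\<^sup>2)\<^sup>2 * (a1 * a2) / (a1 + a2)\<^sup>2"

definition P :: "complex \<Rightarrow> complex" where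
  "P w = complex_of_real (a1 + a2) / cnj d * w\<^sup>2 + complex_of_real \<nu> * w + complex_of_real (a1 + a2) / d"

definition D :: "complex \<Rightarrow> complex" where
  "D w = (w - w1) * (w - w2) * ((1 - cnj w1 * w) * (1 - cnj w2 * w))"

definition h :: "complex \<Rightarrow> complex" where
  "h t = 1 / 2 + P (W t) / (2 * \<delta> t * r (W t))"

definition K :: "complex \<Rightarrow> complex" where
  "K w = 1 / 4 - complex_of_real \<mu> * w\<^sup>2 / D w"

text \<open>Away from critical points this is \<open>norm (h t) + norm (h (\<sigma> t))\<close> in
  terms of \<open>w = W t\<close>, so that estimates near the boundary of \<open>Y\<close> become
  continuity on an annulus.\<close>

definition M :: "complex \<Rightarrow> real" where
  "M w = sqrt (1 / 2 + 2 * norm (K w) + 2 * norm (1 / 4 - K w))"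

section \<open>The weight over the unit circle\<close>

lemma \<mu>_nonneg: "0 \<le> \<mu>"
  using a1_pos a2_pos by (simp add: \<mu>_def)

text \<open>Comparing coefficients fixes the constants: degrees 4 and 0 agree because
  \<open>w1 * w2\<close> is the square of \<open>(a1 + a2) / d\<close>, \<open>\<nu>\<close> matches
  degrees 3 and 1, and the excess in degree 2 is \<open>4 * \<mu>\<close>.\<close>

lemma P_square: "(P w)\<^sup>2 = D w - 4 * complex_of_real \<mu> * w\<^sup>2"
proof -
  define e where "e = cnj d"
  define A where "A = complex_of_real (a1 + a2)"
  define b where "b = complex_of_real (a1 - a2)"
  have nz: "A \<noteq> 0" "e \<noteq> 0"
    using a1_pos a2_pos d unfolding A_def e_def of_real_eq_0_iff by auto
  have n2: "complex_of_real (((a1 + a2) / norm d)\<^sup>2) = A\<^sup>2 / (d * e)"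
    unfolding A_def e_def by (simp add: power_divide complex_norm_square[symmetric])
  have \<nu>: "complex_of_real \<nu> = - (b / A) * (1 + A\<^sup>2 / (d * e))"
    unfolding n2[symmetric] unfolding A_def b_def \<nu>_def by (simp add: minus_divide_left)
  have "4 * complex_of_real (a1 * a2) = A\<^sup>2 - b\<^sup>2"
    unfolding A_def b_def by (simp add: power2_eq_square algebra_simps)
  then have \<mu>: "4 * complex_of_real \<mu> = (1 - A\<^sup>2 / (d * e))\<^sup>2 * (A\<^sup>2 - b\<^sup>2) / A\<^sup>2"
    unfolding n2[symmetric] unfolding A_def b_def \<mu>_def by simp
  have s: "w1 + w2 = 2 * b / d" "w1 * w2 = A\<^sup>2 / d\<^sup>2"
    using w_sum w_prod by (simp_all add: A_def b_def power_divide)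
  have cs: "cnj w1 + cnj w2 = 2 * b / e" "cnj w1 * cnj w2 = A\<^sup>2 / e\<^sup>2"
    using arg_cong[OF s(1), of cnj] arg_cong[OF s(2), of cnj] by (simp_all add: A_def b_def e_def)
  have "D w = (w\<^sup>2 - (w1 + w2) * w + w1 * w2) * (1 - (cnj w1 + cnj w2) * w + (cnj w1 * cnj w2) * w\<^sup>2)"
    unfolding D_def by algebra
  also have "\<dots> = (w\<^sup>2 - 2 * b / d * w + A\<^sup>2 / d\<^sup>2) * (1 - 2 * b / e * w + A\<^sup>2 / e\<^sup>2 * w\<^sup>2)"
    unfolding s cs ..
  finally have Dw: "D w = \<dots>" .
  define f g j where "f = 1 / d" and "g = 1 / e" and "j = 1 / A"
  have Aj: "A * j = 1" using nz by (simp add: j_def)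
  have "P w = A * g * w\<^sup>2 - b * j * (1 + A\<^sup>2 * f * g) * w + A * f"
    unfolding P_def \<nu> by (simp add: A_def e_def f_def g_def j_def)
  moreover have "D w = (w\<^sup>2 - 2 * b * f * w + A\<^sup>2 * f\<^sup>2) * (1 - 2 * b * g * w + A\<^sup>2 * g\<^sup>2 * w\<^sup>2)"
    unfolding Dw by (simp add: f_def g_def power_divide)
  moreover have "4 * complex_of_real \<mu> = (1 - A\<^sup>2 * f * g)\<^sup>2 * (1 - b\<^sup>2 * j\<^sup>2)"
    unfolding \<mu> using nz by (simp add: f_def g_def j_def field_simps)
  ultimately show ?thesis using Aj by algebra
qed

lemma D_W: "t \<noteq> 0 \<Longrightarrow> D (W t) = (\<delta> t)\<^sup>2 * (r (W t))\<^sup>2"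
  by (simp add: D_def \<delta>_square r_square)

lemma h_\<sigma>: "t \<noteq> 0 \<Longrightarrow> h (\<sigma> t) = 1 / 2 - P (W t) / (2 * \<delta> t * r (W t))"
  by (simp add: h_def W_\<sigma> \<delta>_\<sigma>)

lemma P_quotient_square:
  assumes "t \<in> Y" "\<delta> t \<noteq> 0"
  shows "(P (W t) / (2 * \<delta> t * r (W t)))\<^sup>2 = K (W t)"
proof -
  have "t \<noteq> 0" "r (W t) \<noteq> 0" using assms r_nonzero by (auto simp: Y_def)
  then have "D (W t) \<noteq> 0" using assms by (simp add: D_W)
  moreover have "(P (W t) / (2 * \<delta> t * r (W t)))\<^sup>2 = (P (W t))\<^sup>2 / (4 * D (W t))"
    using \<open>t \<noteq> 0\<close> by (simp add: D_W power_divide power_mult_distrib mult_ac)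
  ultimately show ?thesis
    unfolding K_def P_square by (simp add: field_simps)
qed

lemma h_mult_h_\<sigma>:
  assumes "t \<in> Y" "\<delta> t \<noteq> 0"
  shows "h t * h (\<sigma> t) = complex_of_real \<mu> * (W t)\<^sup>2 / D (W t)"
proof -
  have "t \<noteq> 0" using assms by (auto simp: Y_def)
  then have "h t * h (\<sigma> t) = 1 / 4 - (P (W t) / (2 * \<delta> t * r (W t)))\<^sup>2"
    unfolding h_\<sigma>[OF \<open>t \<noteq> 0\<close>] unfolding h_def by (simp add: power2_eq_square algebra_simps)
  then show ?thesis
    unfolding P_quotient_square[OF assms] K_def by simp
qed

text \<open>Square and apply the parallelogram law. The right side sees \<open>k\<close> only
  through \<open>k\<^sup>2\<close>, which makes it a function of \<open>W\<close>.\<close>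

lemma norm_add_norm_diff:
  fixes a k :: complex
  shows "norm (a + k) + norm (a - k) = sqrt (2 * (norm a)\<^sup>2 + 2 * norm (k\<^sup>2) + 2 * norm (a\<^sup>2 - k\<^sup>2))"
proof -
  have "(norm (a + k) + norm (a - k))\<^sup>2 = (norm (a + k))\<^sup>2 + (norm (a - k))\<^sup>2 + 2 * norm ((a + k) * (a - k))"
    by (simp only: norm_mult power2_sum mult.assoc)
  also have "(norm (a + k))\<^sup>2 + (norm (a - k))\<^sup>2 = 2 * (norm a)\<^sup>2 + 2 * (norm k)\<^sup>2"
    by (simp only: cmod_power2) (simp add: power2_eq_square algebra_simps)
  also have "(a + k) * (a - k) = a\<^sup>2 - k\<^sup>2"
    by (simp add: power2_eq_square algebra_simps)
  finally show ?thesis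
    by (simp add: norm_power real_sqrt_unique)
qed

lemma norm_h_add:
  assumes "t \<in> Y" "\<delta> t \<noteq> 0"
  shows "norm (h t) + norm (h (\<sigma> t)) = M (W t)"
proof -
  have "t \<noteq> 0" using assms by (auto simp: Y_def)
  show ?thesis
    unfolding h_\<sigma>[OF \<open>t \<noteq> 0\<close>] unfolding h_def norm_add_norm_diff P_quotient_square[OF assms] M_def
    by (simp add: power2_eq_square)
qed

lemma D_nonzero:
  assumes "norm w \<le> 1" "norm w1 < norm w" "norm w2 < norm w"
  shows "D w \<noteq> 0"
  using Re_one_minus_pos[OF w1_less assms(1)] Re_one_minus_pos[OF w2_less assms(1)] assms
  by (auto simp: D_def simp del: minus_complex.simps times_complex.simps)

text \<open>On the circle \<open>1 - cnj u * w\<close> is \<open>w * cnj (w - u)\<close>, so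
  \<open>D w / w\<^sup>2\<close> is a positive number \<open>N\<close> and \<open>P w / w\<close> is
  real. Hence \<open>N - 4 * \<mu>\<close> is the square of a real number, and \<open>K w\<close>
  and \<open>1 / 4 - K w\<close> are both real and nonnegative.\<close>

lemma M_eq_1:
  assumes "norm w = 1"
  shows "M w = 1"
proof -
  have ww: "w * cnj w = 1" using assms by (simp add: complex_norm_square[symmetric])
  have wnz: "w \<noteq> 0" using assms by auto
  define N where "N = (norm (w - w1))\<^sup>2 * (norm (w - w2))\<^sup>2"
  have Npos: "0 < N" using assms w1_less w2_less unfolding N_def by (intro mult_pos_pos) auto
  have c: "1 - cnj u * w = w * cnj (w - u)" for u
    using ww by (simp add: algebra_simps)
  have DN: "D w = w\<^sup>2 * complex_of_real N"
    unfolding D_def N_def c of_real_mult complex_norm_square by (simp add: power2_eq_square mult_ac)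
  have 1: "1 / 4 - K w = complex_of_real (\<mu> / N)"
    unfolding K_def DN using wnz by simp
  have 2: "K w = complex_of_real (1 / 4 - \<mu> / N)"
    using 1 by (simp add: algebra_simps)
  define x where "x = (a1 + a2) * (2 * Re (w / cnj d)) + \<nu>"
  have "P w / w = complex_of_real (a1 + a2) * (w / cnj d + 1 / (d * w)) + complex_of_real \<nu>"
    unfolding P_def using wnz by (simp add: field_simps power2_eq_square)
  also have "1 / (d * w) = cnj (w / cnj d)"
    using ww wnz by (simp add: field_simps)
  also have "w / cnj d + cnj (w / cnj d) = complex_of_real (2 * Re (w / cnj d))"
    by (rule complex_add_cnj)
  finally have "P w / w = complex_of_real x"
    unfolding x_def by simp
  then have "P w = w * complex_of_real x" using wnz by (simp add: field_simps)
  then have "(w * complex_of_real x)\<^sup>2 = w\<^sup>2 * complex_of_real N - 4 * complex_of_real \<mu> * w\<^sup>2"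
    using P_square[of w] DN by simp
  then have "w\<^sup>2 * complex_of_real (x\<^sup>2) = w\<^sup>2 * complex_of_real (N - 4 * \<mu>)"
    by (simp add: power_mult_distrib algebra_simps)
  then have "x\<^sup>2 = N - 4 * \<mu>" using wnz by (metis mult_cancel_left of_real_eq_iff power_not_zero)
  then have "4 * \<mu> \<le> N" using zero_le_power2[of x] by linarith
  then have "0 \<le> 1 / 4 - \<mu> / N" using Npos by (simp add: field_simps)
  moreover have "0 \<le> \<mu> / N" using \<mu>_nonneg Npos by simp
  ultimately have "norm (1 / 4 - K w) = \<mu> / N" "norm (K w) = 1 / 4 - \<mu> / N"
    unfolding 1 unfolding 2 norm_of_real by linarith+
  then show ?thesis
    by (simp add: M_def)
qed

lemma M_near_circle:
  assumes "0 < \<epsilon>"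
  shows "\<exists>\<rho>0<1. \<forall>w. \<rho>0 \<le> norm w \<and> norm w < 1 \<longrightarrow> norm w1 < norm w \<and> norm w2 < norm w \<and> M w \<le> 1 + \<epsilon>"
proof -
  obtain \<rho>1 where \<rho>1: "max (norm w1) (norm w2) < \<rho>1" "\<rho>1 < 1"
    using dense[of "max (norm w1) (norm w2)" 1] w1_less w2_less by auto
  define S :: "complex set" where "S = {w. \<rho>1 \<le> norm w \<and> norm w \<le> 1}"
  have "compact S"
  proof -
    have "closed S" unfolding S_def by (intro closed_Collect_conj closed_Collect_le continuous_intros)
    moreover have "bounded S" unfolding S_def bounded_iff by auto
    ultimately show ?thesis by (simp add: compact_eq_bounded_closed)
  qed
  have "continuous_on S M"
  proof -
    have "D w \<noteq> 0" if "w \<in> S" for w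
      using that \<rho>1 by (intro D_nonzero) (auto simp: S_def)
    then show ?thesis
      unfolding M_def K_def D_def by (intro continuous_intros) auto
  qed
  then have "uniformly_continuous_on S M"
    using \<open>compact S\<close> compact_uniformly_continuous by blast
  then obtain \<eta> where \<eta>: "0 < \<eta>" "\<And>w w'. w \<in> S \<Longrightarrow> w' \<in> S \<Longrightarrow> dist w' w < \<eta> \<Longrightarrow> dist (M w') (M w) < \<epsilon>"
    using \<open>0 < \<epsilon>\<close> unfolding uniformly_continuous_on_def by metis
  define \<rho>0 where "\<rho>0 = max \<rho>1 (1 - \<eta> / 2)"
  have "norm w1 < norm w \<and> norm w2 < norm w \<and> M w \<le> 1 + \<epsilon>" if "\<rho>0 \<le> norm w" "norm w < 1" for w
  proof -
    have w: "w \<in> S" "w \<noteq> 0" using that \<rho>1 norm_ge_zero[of w1] by (auto simp: S_def \<rho>0_def simp del: norm_ge_zero)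
    \<comment> \<open>The radial projection to the circle, where \<open>M\<close> is
      \<open>1\<close>.\<close>
    define w' where "w' = w / complex_of_real (norm w)"
    have n: "norm w' = 1" using w by (simp add: w'_def norm_divide)
    then have "w' \<in> S" using \<rho>1 by (simp add: S_def)
    have "w' - w = w' * complex_of_real (1 - norm w)"
      using w by (simp add: w'_def field_simps)
    then have "norm (w' - w) = norm w' * \<bar>1 - norm w\<bar>"
      by (metis norm_mult norm_of_real)
    then have "dist w' w < \<eta>"
      using n that \<eta>(1) by (simp add: dist_norm \<rho>0_def)
    then have "dist (M w') (M w) < \<epsilon>" using \<eta>(2) w \<open>w' \<in> S\<close> by blast
    then show ?thesis using M_eq_1[OF n] that \<rho>1 by (auto simp: dist_real_def \<rho>0_def)
  qed
  moreover have "\<rho>0 < 1" using \<rho>1 \<eta> by (simp add: \<rho>0_def)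
  ultimately show ?thesis by blast
qed


section \<open>The weighted trace and its removable singularities\<close>

lemma \<delta>_1_nonzero: "\<delta> 1 \<noteq> 0"
  using a1_pos a2_pos unfolding \<delta>_1 by (simp flip: of_real_add)

lemma h_1 [simp]: "h 1 = 1"
proof -
  have "complex_of_real (a1 + a2) \<noteq> 0" using a1_pos a2_pos unfolding of_real_eq_0_iff by simp
  then show ?thesis by (simp add: h_def P_def \<delta>_1 del: distrib_left_numeral flip: distrib_left)
qed

lemma deriv_W_1: "deriv W 1 = - \<delta> 1"
  using W_has_field_derivative[of 1] by (simp add: DERIV_imp_deriv)

lemma W_eq_0: "t \<noteq> 0 \<Longrightarrow> W t = 0 \<Longrightarrow> t = 1 \<or> t = \<sigma> 1"
proof -
  assume "t \<noteq> 0" "W t = 0"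
  then have "1 - t = 0 \<or> complex_of_real a1 * t + complex_of_real a2 = 0"
    by (simp add: W_def)
  then show ?thesis
  proof
    assume "complex_of_real a1 * t + complex_of_real a2 = 0"
    then have "t = - complex_of_real a2 / complex_of_real a1"
      using A1 by (metis add_eq_0_iff2 nonzero_mult_div_cancel_left)
    then show ?thesis by (simp add: \<sigma>_def)
  qed simp
qed

text \<open>The points where the formula for \<open>u0\<close> breaks down: the two zeros of
  \<open>W\<close>, and the critical points, where \<open>h\<close> has \<open>\<delta>\<close> in a
  denominator.\<close>

definition Z :: "complex set" where
  "Z = {1, \<sigma> 1} \<union> {t. t \<noteq> 0 \<and> \<delta> t = 0}"

lemma finite_Z: "finite Z"
proof -
  have "{t. t \<noteq> 0 \<and> \<delta> t = 0} \<subseteq> {t. poly [: complex_of_real a2, 0, complex_of_real a1 :] t = 0}"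
    by (auto simp: \<delta>_def field_simps power2_eq_square)
  moreover have "finite \<dots>"
    using A1 by (intro poly_roots_finite) simp
  ultimately show ?thesis
    unfolding Z_def using finite_subset by blast
qed

lemma holomorphic_h: "h holomorphic_on Y - {t. \<delta> t = 0}"
proof -
  have "Y \<subseteq> - {0}" by (auto simp: Y_def)
  have W: "W holomorphic_on Y - {t. \<delta> t = 0}" and \<delta>: "\<delta> holomorphic_on Y - {t. \<delta> t = 0}"
    using \<open>Y \<subseteq> - {0}\<close>
    by (auto intro: holomorphic_on_subset[OF holomorphic_W] holomorphic_on_subset[OF holomorphic_\<delta>])
  have "(r \<circ> W) holomorphic_on Y - {t. \<delta> t = 0}"
    by (rule holomorphic_on_compose_gen[OF W r_holomorphic]) (auto simp: Y_def)
  then have rW: "(\<lambda>t. r (W t)) holomorphic_on Y - {t. \<delta> t = 0}"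
    by (simp add: o_def)
  have "r (W t) \<noteq> 0" if "t \<in> Y" for t
    using that r_nonzero by (auto simp: Y_def)
  then show ?thesis
    unfolding h_def P_def by (intro holomorphic_intros W \<delta> rW) auto
qed

lemma \<sigma>_critical:
  assumes "c \<noteq> 0" "\<delta> c = 0"
  shows "\<sigma> c = c"
proof -
  have "complex_of_real a1 * c * c = - complex_of_real a2"
    using assms by (simp add: \<delta>_def field_simps add_eq_0_iff)
  then have "c = - complex_of_real a2 / (complex_of_real a1 * c)"
    using assms A1 by (metis mult_eq_0_iff nonzero_mult_div_cancel_left)
  then show ?thesis by (simp add: \<sigma>_def)
qed

lemma W_critical_nonzero:
  assumes "c \<noteq> 0" "\<delta> c = 0"
  shows "W c \<noteq> 0"
proof
  assume "W c = 0"
  then have "w1 * w2 = 0" using \<delta>_square[OF assms(1)] assms by simp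
  then show False
    using \<delta>_1_nonzero w_prod by (simp add: \<delta>_1)
qed

definition u0 :: "(complex \<Rightarrow> complex) \<Rightarrow> complex \<Rightarrow> complex" where
  "u0 g t = (h t * g t + h (\<sigma> t) * g (\<sigma> t)) / W t"

lemma u0_\<sigma>: "t \<noteq> 0 \<Longrightarrow> u0 g (\<sigma> t) = u0 g t"
  by (simp add: u0_def \<sigma>_\<sigma> W_\<sigma> add.commute)

lemma holomorphic_on_o_\<sigma>:
  assumes "f holomorphic_on X" "Y' \<subseteq> - {0}" "\<sigma> ` Y' \<subseteq> X"
  shows "(\<lambda>t. f (\<sigma> t)) holomorphic_on Y'"
  using holomorphic_on_compose_gen[OF holomorphic_on_subset[OF holomorphic_\<sigma> assms(2)] assms(1,3)]
  by (simp add: o_def)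

lemma holomorphic_u0:
  assumes "g holomorphic_on Y"
  shows "u0 g holomorphic_on Y - Z"
proof -
  have sub: "Y - Z \<subseteq> - {0}" by (auto simp: Y_def)
  have "\<sigma> t \<in> Y - {t. \<delta> t = 0}" if "t \<in> Y - Z" for t
  proof -
    have "t \<noteq> 0" "\<delta> t \<noteq> 0" using that by (auto simp: Z_def Y_def)
    then show ?thesis using that \<sigma>_in_Y[of t] by (simp add: \<delta>_\<sigma>)
  qed
  then have "\<sigma> ` (Y - Z) \<subseteq> Y - {t. \<delta> t = 0}" by blast
  then have "(\<lambda>t. h (\<sigma> t)) holomorphic_on Y - Z" "(\<lambda>t. g (\<sigma> t)) holomorphic_on Y - Z"
    using sub by (auto intro: holomorphic_on_o_\<sigma>[OF holomorphic_h] holomorphic_on_o_\<sigma>[OF assms])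
  moreover have "h holomorphic_on Y - Z"
    using sub by (intro holomorphic_on_subset[OF holomorphic_h]) (auto simp: Z_def)
  moreover have "g holomorphic_on Y - Z" "W holomorphic_on Y - Z"
    using sub by (auto intro: holomorphic_on_subset[OF assms] holomorphic_on_subset[OF holomorphic_W])
  moreover have "W t \<noteq> 0" if "t \<in> Y - Z" for t
    using that W_eq_0[of t] by (auto simp: Z_def Y_def)
  ultimately show ?thesis
    unfolding u0_def by (intro holomorphic_intros) auto
qed

text \<open>Only the sheet at \<open>1\<close> contributes: \<open>h t\<close> tends to
  \<open>1\<close>, while \<open>h (\<sigma> t)\<close> is of order \<open>(W t)\<^sup>2\<close> and
  outweighs the division by \<open>W t\<close>, whatever the bounded factor
  \<open>g (\<sigma> t)\<close> is.\<close>

lemma tendsto_u0_1: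
  assumes hol: "g holomorphic_on Y" and g_le: "\<And>t. t \<in> Y \<Longrightarrow> norm (g t) \<le> 1" and "g 1 = 0"
  shows "(u0 g \<longlongrightarrow> deriv g 1 / deriv W 1) (at 1)"
proof -
  have Ynhds: "\<forall>\<^sub>F t in at 1. t \<in> Y"
    using open_Y by (intro eventually_at_in_open') auto
  have cont: "isCont W 1" "isCont \<delta> 1"
    using W_has_field_derivative[of 1] \<delta>_has_field_derivative[of 1] DERIV_isCont by auto
  have W0: "(W \<longlongrightarrow> 0) (at 1)"
    using cont(1) by (simp add: isCont_def)
  have \<delta>nz: "\<forall>\<^sub>F t in at 1. \<delta> t \<noteq> 0"
    using cont(2) \<delta>_1_nonzero tendsto_imp_eventually_ne unfolding isCont_def by blast
  have "1 \<in> Y - {t. \<delta> t = 0}"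
    using \<delta>_1_nonzero by simp
  moreover have "open (Y - {t. \<delta> t = 0})"
  proof -
    have "open (Y \<inter> \<delta> -` (- {0}))"
      by (rule continuous_open_preimage[OF continuous_on_\<delta> open_Y]) (auto simp: Y_def)
    moreover have "Y - {t. \<delta> t = 0} = Y \<inter> \<delta> -` (- {0})" by auto
    ultimately show ?thesis by simp
  qed
  ultimately have "isCont h 1"
    using holomorphic_h holomorphic_on_imp_continuous_on continuous_on_eq_continuous_at by blast
  then have h1: "(h \<longlongrightarrow> 1) (at 1)" by (simp add: isCont_def)
  have "(g has_field_derivative deriv g 1) (at 1)"
    using hol open_Y holomorphic_derivI one_in_Y by blast
  then have g': "((\<lambda>t. g t / (t - 1)) \<longlongrightarrow> deriv g 1) (at 1)"
    using \<open>g 1 = 0\<close> by (simp add: has_field_derivative_iff)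
  have "(W has_field_derivative deriv W 1) (at 1)"
    using W_has_field_derivative[of 1] by (simp add: deriv_W_1)
  then have W': "((\<lambda>t. W t / (t - 1)) \<longlongrightarrow> deriv W 1) (at 1)"
    by (simp add: has_field_derivative_iff)
  have W'nz: "deriv W 1 \<noteq> 0"
    using \<delta>_1_nonzero by (simp add: deriv_W_1)
  have "((\<lambda>t. h t * ((g t / (t - 1)) / (W t / (t - 1)))) \<longlongrightarrow> 1 * (deriv g 1 / deriv W 1)) (at 1)"
    by (intro tendsto_intros h1 g' W' W'nz)
  then have "((\<lambda>t. h t * g t / W t) \<longlongrightarrow> 1 * (deriv g 1 / deriv W 1)) (at 1)"
    by (rule Lim_transform_eventually) (simp add: eventually_at_filter)
  then have first: "((\<lambda>t. h t * g t / W t) \<longlongrightarrow> deriv g 1 / deriv W 1) (at 1)"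
    by simp
  have "isCont D 0" unfolding D_def by (intro continuous_intros)
  then have D0: "((\<lambda>t. D (W t)) \<longlongrightarrow> D 0) (at 1)"
    using W0 isCont_tendsto_compose by blast
  have "D 0 \<noteq> 0"
    using D_W[of 1] \<delta>_1_nonzero by simp
  have "((\<lambda>t. complex_of_real \<mu> * W t / (D (W t) * h t)) \<longlongrightarrow> complex_of_real \<mu> * 0 / (D 0 * 1)) (at 1)"
    by (intro tendsto_intros W0 D0 h1) (use \<open>D 0 \<noteq> 0\<close> in auto)
  then have *: "((\<lambda>t. norm (complex_of_real \<mu> * W t / (D (W t) * h t))) \<longlongrightarrow> 0) (at 1)"
    by (simp add: tendsto_norm_zero)
  have hnz: "\<forall>\<^sub>F t in at 1. h t \<noteq> 0"
    using h1 tendsto_imp_eventually_ne by (metis zero_neq_one)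
  have "((\<lambda>t. h (\<sigma> t) * g (\<sigma> t) / W t) \<longlongrightarrow> 0) (at 1)"
  proof (rule Lim_null_comparison[OF _ *])
    show "\<forall>\<^sub>F t in at 1. norm (h (\<sigma> t) * g (\<sigma> t) / W t) \<le> norm (complex_of_real \<mu> * W t / (D (W t) * h t))"
      using Ynhds \<delta>nz hnz
    proof eventually_elim
      case (elim t)
      then have "h (\<sigma> t) = (h t * h (\<sigma> t)) / h t" by simp
      also have "\<dots> = complex_of_real \<mu> * (W t)\<^sup>2 / (D (W t) * h t)"
        using elim by (simp add: h_mult_h_\<sigma>)
      finally have "h (\<sigma> t) = complex_of_real \<mu> * (W t)\<^sup>2 / (D (W t) * h t)" .
      then have "h (\<sigma> t) * g (\<sigma> t) / W t = (complex_of_real \<mu> * W t / (D (W t) * h t)) * g (\<sigma> t)"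
        by (simp add: power2_eq_square)
      then show ?case
        using g_le[OF \<sigma>_in_Y[OF elim(1)]] by (metis mult_left_le norm_ge_zero norm_mult)
    qed
  qed
  from tendsto_add[OF first this] show ?thesis
    unfolding u0_def[abs_def] by (simp add: add_divide_distrib)
qed

text \<open>The odd part of \<open>h\<close> is multiplied by \<open>g t - g (\<sigma> t)\<close>,
  which vanishes at the fixed point \<open>c\<close> of \<open>\<sigma>\<close>; this compensates
  the simple zero of \<open>\<delta>\<close>.\<close>

lemma tendsto_u0_critical:
  assumes hol: "g holomorphic_on Y" and c: "c \<in> Y" "\<delta> c = 0"
  shows "\<exists>l. (u0 g \<longlongrightarrow> l) (at c)"
proof -
  have cnz: "c \<noteq> 0" using c by (auto simp: Y_def)
  have \<sigma>c: "\<sigma> c = c" using \<sigma>_critical[OF cnz c(2)] .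
  have holc: "(\<lambda>t. g (\<sigma> t)) holomorphic_on Y"
    by (rule holomorphic_on_o_\<sigma>[OF hol]) (use \<sigma>_in_Y in \<open>auto simp: Y_def\<close>)
  have "(\<lambda>t. g t - g (\<sigma> t)) holomorphic_on Y"
    by (intro holomorphic_intros hol holc)
  then obtain g' where "((\<lambda>t. g t - g (\<sigma> t)) has_field_derivative g') (at c)"
    using holomorphic_derivI open_Y c(1) by blast
  then have 1: "((\<lambda>t. (g t - g (\<sigma> t)) / (t - c)) \<longlongrightarrow> g') (at c)"
    by (simp add: has_field_derivative_iff \<sigma>c)
  define \<delta>' where "\<delta>' = (complex_of_real a1 - complex_of_real a2 / c\<^sup>2) / d"
  have 2: "((\<lambda>t. \<delta> t / (t - c)) \<longlongrightarrow> \<delta>') (at c)"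
    using \<delta>_has_field_derivative[OF cnz] c(2) by (simp add: has_field_derivative_iff \<delta>'_def)
  have "complex_of_real a2 / c\<^sup>2 = - complex_of_real a1"
    using c(2) cnz by (simp add: \<delta>_def field_simps power2_eq_square add_eq_0_iff)
  then have 3: "\<delta>' \<noteq> 0" unfolding \<delta>'_def using A1 d by simp
  have "((\<lambda>t. ((g t - g (\<sigma> t)) / (t - c)) / (\<delta> t / (t - c))) \<longlongrightarrow> g' / \<delta>') (at c)"
    by (rule tendsto_divide[OF 1 2 3])
  then have 4: "((\<lambda>t. (g t - g (\<sigma> t)) / \<delta> t) \<longlongrightarrow> g' / \<delta>') (at c)"
    by (rule Lim_transform_eventually) (auto simp: eventually_at_filter)
  have lim: "(f \<longlongrightarrow> f c) (at c)" if "f holomorphic_on Y" for f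
    using that open_Y c(1) holomorphic_on_imp_continuous_on continuous_on_eq_continuous_at isCont_def by blast
  note holW = holomorphic_W_Y and holrW = holomorphic_r_W
  have "(\<lambda>t. P (W t)) holomorphic_on Y"
    unfolding P_def by (intro holomorphic_intros holW)
  note lims = lim[OF this] lim[OF holrW] lim[OF holW] lim[OF hol] lim[OF holc]
  have nz: "2 * r (W c) \<noteq> 0" "W c \<noteq> 0"
    using r_nonzero[of "W c"] W_critical_nonzero[OF cnz c(2)] c by (auto simp: Y_def)
  have "((\<lambda>t. ((g t + g (\<sigma> t)) / 2 + P (W t) / (2 * r (W t)) * ((g t - g (\<sigma> t)) / \<delta> t)) / W t) \<longlongrightarrow>
     ((g c + g (\<sigma> c)) / 2 + P (W c) / (2 * r (W c)) * (g' / \<delta>')) / W c) (at c)"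
    by (intro tendsto_intros lims 4 nz) simp
  moreover have "\<forall>\<^sub>F t in at c. ((g t + g (\<sigma> t)) / 2 + P (W t) / (2 * r (W t)) * ((g t - g (\<sigma> t)) / \<delta> t)) / W t = u0 g t"
    using eventually_at_in_open'[OF open_Y c(1)]
  proof eventually_elim
    case (elim t)
    then have "t \<noteq> 0" by (simp add: Y_def)
    then show ?case
      unfolding u0_def h_\<sigma>[OF \<open>t \<noteq> 0\<close>] unfolding h_def
      by (intro arg_cong2[where f = "(/)"] refl) (simp add: ring_distribs add_divide_distrib diff_divide_distrib mult_ac)
  qed
  ultimately show ?thesis
    using Lim_transform_eventually by blast
qed

text \<open>\<open>u\<close> plays the role of the quotient \<open>g w / w\<close> in the Schwarz
  lemma. Its bound holds because both \<open>norm (h t) + norm (h (\<sigma> t))\<close> and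
  \<open>norm (W t)\<close> approach \<open>1\<close> at the boundary.\<close>

lemma Schwarz_multiplier:
  assumes hol: "g holomorphic_on Y" and g_le: "\<And>t. t \<in> Y \<Longrightarrow> norm (g t) \<le> 1" and "g 1 = 0"
  shows "\<exists>u. u holomorphic_on Y \<and> (\<forall>t\<in>Y. norm (u t) \<le> 1) \<and> u 1 = deriv g 1 / deriv W 1 \<and>
    (\<forall>t\<in>Y - Z. u t * W t = h t * g t + h (\<sigma> t) * g (\<sigma> t))"
proof -
  have lim1: "(u0 g \<longlongrightarrow> deriv g 1 / deriv W 1) (at 1)"
    by (rule tendsto_u0_1[OF assms])
  have lim: "\<exists>l. (u0 g \<longlongrightarrow> l) (at c)" if c: "c \<in> Y \<inter> Z" for c
  proof -
    consider "c = 1" | "c = \<sigma> 1" | "\<delta> c = 0" "c \<in> Y" using c unfolding Z_def by blast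
    then show ?thesis
    proof cases
      case 2
      \<comment> \<open>At the other zero of \<open>W\<close> the limit is carried over from
        \<open>1\<close> by the invariance of \<open>u0\<close> under
        \<open>\<sigma>\<close>.\<close>
      have "isCont \<sigma> c"
        using holomorphic_on_imp_continuous_on[OF holomorphic_\<sigma>] 2 \<sigma>_nonzero[of 1]
          continuous_on_eq_continuous_at[of "- {0}" \<sigma>] by auto
      then have "(\<sigma> \<longlongrightarrow> 1) (at c)" by (simp add: isCont_def 2 \<sigma>_\<sigma>)
      moreover have "\<forall>\<^sub>F t in at c. \<sigma> t \<noteq> 1"
      proof -
        have "\<forall>\<^sub>F t in at c. t \<in> - {0} - {c}"
          using 2 \<sigma>_nonzero[of 1] by (intro eventually_at_in_open) auto
        then show ?thesis
          by eventually_elim (use 2 \<sigma>_\<sigma> in force)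
      qed
      ultimately have "filterlim \<sigma> (at 1) (at c)"
        by (simp add: filterlim_at)
      then have "((\<lambda>t. u0 g (\<sigma> t)) \<longlongrightarrow> deriv g 1 / deriv W 1) (at c)"
        using lim1 filterlim_compose by blast
      moreover have "\<forall>\<^sub>F t in at c. u0 g (\<sigma> t) = u0 g t"
      proof -
        have "\<forall>\<^sub>F t in at c. t \<in> - {0}"
          using 2 \<sigma>_nonzero[of 1] by (intro eventually_at_in_open') auto
        then show ?thesis by eventually_elim (simp add: u0_\<sigma>)
      qed
      ultimately show ?thesis using Lim_transform_eventually by blast
    qed (use lim1 tendsto_u0_critical[OF hol] in blast)+
  qed
  define u where "u t = (if t \<in> Z then Lim (at t) (u0 g) else u0 g t)" for t
  have u_eq: "\<forall>\<^sub>F t in at c. u0 g t = u t" for c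
  proof -
    have "open (- (Z - {c}))"
      using finite_Z by (intro open_Compl finite_imp_closed) auto
    then have "\<forall>\<^sub>F t in at c. t \<in> - (Z - {c}) - {c}"
      by (intro eventually_at_in_open) auto
    then show ?thesis by eventually_elim (auto simp: u_def)
  qed
  have holu: "u holomorphic_on Y"
  proof (rule no_isolated_singularity'[where K = "Y \<inter> Z"])
    fix c assume c: "c \<in> Y \<inter> Z"
    then obtain l where l: "(u0 g \<longlongrightarrow> l) (at c)" using lim by blast
    then have "u c = l" using c by (simp add: u_def tendsto_Lim)
    moreover have "(u \<longlongrightarrow> l) (at c)"
      using l u_eq Lim_transform_eventually by blast
    ultimately show "(u \<longlongrightarrow> u c) (at c within Y)"
      using tendsto_within_subset by blast
  next
    show "u holomorphic_on Y - Y \<inter> Z"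
      using holomorphic_u0[OF hol]
      by (rule holomorphic_on_subset[THEN holomorphic_transform]) (auto simp: u_def)
  qed (use open_Y finite_Z in auto)
  have u1: "u 1 = deriv g 1 / deriv W 1"
    using lim1 by (simp add: u_def Z_def tendsto_Lim)
  have uW: "u t * W t = h t * g t + h (\<sigma> t) * g (\<sigma> t)" if "t \<in> Y - Z" for t
  proof -
    have "W t \<noteq> 0" using that W_eq_0[of t] by (auto simp: Z_def Y_def)
    then show ?thesis using that by (simp add: u_def u0_def)
  qed
  have "norm (u t) \<le> 1" if "t \<in> Y" for t
  proof (rule norm_bound_from_frontier[OF holu _ that])
    fix \<epsilon> :: real assume "0 < \<epsilon>"
    obtain \<rho>0 where \<rho>0: "\<rho>0 < 1" "\<And>w. \<rho>0 \<le> norm w \<Longrightarrow> norm w < 1 \<Longrightarrow> norm w1 < norm w \<and> norm w2 < norm w \<and> M w \<le> 1 + \<epsilon> / 2"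
      using M_near_circle[of "\<epsilon> / 2"] \<open>0 < \<epsilon>\<close> by auto
    \<comment> \<open>The second entry gives
      \<open>1 + \<epsilon> / 2 \<le> (1 + \<epsilon>) * norm (W t)\<close>, which pays for the
      division by \<open>W\<close>.\<close>
    define \<rho> where "\<rho> = max \<rho>0 ((1 + \<epsilon> / 2) / (1 + \<epsilon>))"
    have "norm (u t) \<le> 1 + \<epsilon>" if t: "t \<in> Y" "\<rho> \<le> norm (W t)" for t
    proof -
      have less: "norm (W t) < 1" "t \<noteq> 0" using t by (auto simp: Y_def)
      have w: "norm w1 < norm (W t)" "norm w2 < norm (W t)" "M (W t) \<le> 1 + \<epsilon> / 2"
        using \<rho>0(2)[of "W t"] t less by (auto simp: \<rho>_def)
      have \<delta>: "\<delta> t \<noteq> 0" using \<delta>_square[OF less(2)] w by auto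
      have "W t \<noteq> 0" using w by auto
      then have "t \<in> Y - Z" using \<delta> t less W_\<sigma>[of 1] by (auto simp: Z_def)
      then have "norm (u t) * norm (W t) = norm (h t * g t + h (\<sigma> t) * g (\<sigma> t))"
        using uW by (metis norm_mult)
      also have "\<dots> \<le> norm (h t) * norm (g t) + norm (h (\<sigma> t)) * norm (g (\<sigma> t))"
        by (metis norm_mult norm_triangle_ineq)
      also have "\<dots> \<le> norm (h t) * 1 + norm (h (\<sigma> t)) * 1"
        using g_le[OF t(1)] g_le[OF \<sigma>_in_Y[OF t(1)]] by (intro add_mono mult_left_mono) auto
      also have "\<dots> \<le> 1 + \<epsilon> / 2"
        using norm_h_add[OF t(1) \<delta>] w(3) by simp
      also have "\<dots> \<le> (1 + \<epsilon>) * norm (W t)"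
        using t(2) \<open>0 < \<epsilon>\<close> by (simp add: \<rho>_def field_simps)
      finally show ?thesis using \<open>W t \<noteq> 0\<close> by simp
    qed
    moreover have "\<rho> < 1" using \<rho>0(1) \<open>0 < \<epsilon>\<close> by (simp add: \<rho>_def)
    ultimately show "\<exists>\<rho>0<1. \<forall>t\<in>Y. \<rho>0 \<le> norm (W t) \<longrightarrow> norm (u t) \<le> 1 + \<epsilon>"
      by blast
  qed
  with holu u1 uW show ?thesis by blast
qed

lemma norm_deriv_le:
  assumes "g holomorphic_on Y" "\<And>t. t \<in> Y \<Longrightarrow> norm (g t) \<le> 1" "g 1 = 0"
  shows "norm (deriv g 1) \<le> norm (deriv W 1)"
proof -
  obtain u where "\<forall>t\<in>Y. norm (u t) \<le> 1" "u 1 = deriv g 1 / deriv W 1"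
    using Schwarz_multiplier[OF assms] by blast
  then have "norm (deriv g 1 / deriv W 1) \<le> 1" using one_in_Y by metis
  then show ?thesis
    using \<delta>_1_nonzero by (simp add: norm_divide deriv_W_1)
qed

text \<open>With \<open>m = (g + W) / 2\<close> and \<open>v = (g - W) / 2\<close> one has \<open>\<bar>m\<bar> \<le> 1 - \<bar>v\<bar>\<^sup>2 / 2\<close>, and \<open>m\<close> is extremal as well.
  The estimate for its trace then leaves no room for \<open>h v\<^sup>2\<close> at the boundary.\<close>

lemma extremal_unique:
  assumes hol: "g holomorphic_on Y" and g_le: "\<And>t. t \<in> Y \<Longrightarrow> norm (g t) \<le> 1" and "g 1 = 0"
    and deriv_eq: "deriv g 1 = deriv W 1" and "t \<in> Y"
  shows "g t = W t"
proof -
  note holW = holomorphic_W_Y and hol\<delta> = holomorphic_\<delta>_Y and holrW = holomorphic_r_W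
  have rnz: "r (W t) \<noteq> 0" if "t \<in> Y" for t
    using that r_nonzero by (auto simp: Y_def)
  define m where "m t = (g t + W t) / 2" for t
  define v where "v t = (g t - W t) / 2" for t
  have holm: "m holomorphic_on Y"
    unfolding m_def by (intro holomorphic_intros hol holW) auto
  have holv: "v holomorphic_on Y"
    unfolding v_def by (intro holomorphic_intros hol holW) auto
  \<comment> \<open>Parallelogram law, followed by
    \<open>sqrt (1 - s) \<le> 1 - s / 2\<close>.\<close>
  have m_le: "norm (m t) \<le> 1 - (norm (v t))\<^sup>2 / 2" if "t \<in> Y" for t
  proof -
    have "(norm (m t))\<^sup>2 + (norm (v t))\<^sup>2 = ((norm (g t))\<^sup>2 + (norm (W t))\<^sup>2) / 2"
      unfolding m_def v_def norm_divide power_divide cmod_power2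
      by (simp add: power2_eq_square field_simps)
    also have "\<dots> \<le> 1"
      using g_le[OF that] that power_le_one[of "norm (g t)" 2] power_le_one[of "norm (W t)" 2]
      by (simp add: Y_def)
    finally have *: "(norm (m t))\<^sup>2 + (norm (v t))\<^sup>2 \<le> 1" .
    then have "0 \<le> 1 - (norm (v t))\<^sup>2 / 2"
      using zero_le_power2[of "norm (m t)"] zero_le_power2[of "norm (v t)"] by linarith
    moreover have "(norm (m t))\<^sup>2 \<le> (1 - (norm (v t))\<^sup>2 / 2)\<^sup>2"
    proof -
      have "(1 - (norm (v t))\<^sup>2 / 2)\<^sup>2 = 1 - (norm (v t))\<^sup>2 + ((norm (v t))\<^sup>2 / 2)\<^sup>2"
        by (simp add: power2_eq_square field_simps)
      then show ?thesis using * zero_le_power2[of "(norm (v t))\<^sup>2 / 2"] by linarith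
    qed
    ultimately show ?thesis using power2_le_imp_le by blast
  qed
  have m_le_1: "norm (m t) \<le> 1" if "t \<in> Y" for t
    using m_le[OF that] zero_le_power2[of "norm (v t)"] by linarith
  have m1: "m 1 = 0" using \<open>g 1 = 0\<close> by (simp add: m_def)
  have "(m has_field_derivative (deriv g 1 + deriv W 1) / 2) (at 1)"
    unfolding m_def using holomorphic_derivI[OF hol open_Y one_in_Y] holomorphic_derivI[OF holW open_Y one_in_Y]
    by (intro DERIV_cdivide DERIV_add)
  then have "deriv m 1 = deriv W 1" using deriv_eq by (simp add: DERIV_imp_deriv)
  then obtain u where u: "u holomorphic_on Y" "\<And>t. t \<in> Y \<Longrightarrow> norm (u t) \<le> 1" "u 1 = 1"
      "\<And>t. t \<in> Y - Z \<Longrightarrow> u t * W t = h t * m t + h (\<sigma> t) * m (\<sigma> t)"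
    using Schwarz_multiplier[OF holm m_le_1 m1] \<delta>_1_nonzero by (auto simp: deriv_W_1)
  \<comment> \<open>\<open>u\<close> attains its bound \<open>1\<close> at the interior point
    \<open>1\<close>, so the weighted trace of \<open>m\<close> is exactly \<open>W\<close>.\<close>
  have "u constant_on Y"
    by (rule maximum_modulus_principle[OF u(1) open_Y connected_Y open_Y order_refl one_in_Y])
       (use u in auto)
  then have u_1: "u t = 1" if "t \<in> Y" for t
    using that u(3) one_in_Y unfolding constant_on_def by metis
  have hv: "norm (h t) * (norm (v t))\<^sup>2 \<le> 2 * (M (W t) - norm (W t))" if t: "t \<in> Y - Z" for t
  proof -
    have t': "t \<in> Y" "\<delta> t \<noteq> 0" using t by (auto simp: Z_def Y_def)
    have "norm (W t) = norm (h t * m t + h (\<sigma> t) * m (\<sigma> t))"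
      using u(4)[OF t] u_1 t' by simp
    also have "\<dots> \<le> norm (h t) * norm (m t) + norm (h (\<sigma> t)) * norm (m (\<sigma> t))"
      by (metis norm_mult norm_triangle_ineq)
    also have "\<dots> \<le> norm (h t) * (1 - (norm (v t))\<^sup>2 / 2) + norm (h (\<sigma> t)) * 1"
      using m_le[OF t'(1)] m_le_1[OF \<sigma>_in_Y[OF t'(1)]] by (intro add_mono mult_left_mono) auto
    also have "\<dots> = M (W t) - norm (h t) * (norm (v t))\<^sup>2 / 2"
      using norm_h_add[OF t'] by (simp add: algebra_simps)
    finally show ?thesis by simp
  qed
  \<comment> \<open>The factor \<open>\<delta>\<close> cancels the poles of \<open>h\<close>, so the
    maximum principle applies to \<open>F\<close> on all of \<open>Y\<close>.\<close>
  define F where "F t = (\<delta> t + P (W t) / r (W t)) / 2 * (v t)\<^sup>2" for t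
  have holF: "F holomorphic_on Y"
    unfolding F_def P_def by (intro holomorphic_intros holW hol\<delta> holrW holv) (use rnz in auto)
  have F_eq: "F t = \<delta> t * h t * (v t)\<^sup>2" if "t \<in> Y - Z" for t
  proof -
    have "\<delta> t \<noteq> 0" "r (W t) \<noteq> 0" using that rnz by (auto simp: Z_def Y_def)
    then show ?thesis by (simp add: F_def h_def field_simps)
  qed
  have "norm (F t) \<le> 0" if "t \<in> Y" for t
  proof (rule norm_bound_from_frontier[OF holF _ that])
    fix \<epsilon> :: real assume "0 < \<epsilon>"
    obtain \<rho>0 where \<rho>0: "\<rho>0 < 1" "\<And>w. \<rho>0 \<le> norm w \<Longrightarrow> norm w < 1 \<Longrightarrow> norm w1 < norm w \<and> norm w2 < norm w \<and> M w \<le> 1 + \<epsilon> / 8"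
      using M_near_circle[of "\<epsilon> / 8"] \<open>0 < \<epsilon>\<close> by auto
    \<comment> \<open>Two errors of size \<open>\<epsilon> / 8\<close> are doubled in
      \<open>hv\<close>, and the bound \<open>2\<close> for \<open>\<delta>\<close> then yields
      \<open>\<epsilon>\<close>.\<close>
    define \<rho> where "\<rho> = max \<rho>0 (1 - \<epsilon> / 8)"
    have "norm (F t) \<le> 0 + \<epsilon>" if t: "t \<in> Y" "\<rho> \<le> norm (W t)" for t
    proof -
      have less: "norm (W t) < 1" "t \<noteq> 0" using t by (auto simp: Y_def)
      have w: "norm w1 < norm (W t)" "norm w2 < norm (W t)" "M (W t) \<le> 1 + \<epsilon> / 8"
        using \<rho>0(2)[of "W t"] t less by (auto simp: \<rho>_def)
      have \<delta>: "\<delta> t \<noteq> 0" using \<delta>_square[OF less(2)] w by auto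
      have "W t \<noteq> 0" using w by auto
      then have tZ: "t \<in> Y - Z" using \<delta> t less W_\<sigma>[of 1] by (auto simp: Z_def)
      have "norm (\<delta> t) \<le> 2"
        using norm_\<delta>_le less by simp
      moreover have "norm (h t) * (norm (v t))\<^sup>2 \<le> \<epsilon> / 2"
        using hv[OF tZ] w(3) t(2) by (simp add: \<rho>_def)
      ultimately have "norm (\<delta> t) * (norm (h t) * (norm (v t))\<^sup>2) \<le> 2 * (\<epsilon> / 2)"
        by (intro mult_mono) auto
      then show ?thesis
        unfolding F_eq[OF tZ] by (simp add: norm_mult norm_power mult.assoc)
    qed
    moreover have "\<rho> < 1" using \<rho>0(1) \<open>0 < \<epsilon>\<close> by (simp add: \<rho>_def)
    ultimately show "\<exists>\<rho>0<1. \<forall>t\<in>Y. \<rho>0 \<le> norm (W t) \<longrightarrow> norm (F t) \<le> 0 + \<epsilon>"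
      by blast
  qed
  then have F0: "F t = 0" if "t \<in> Y" for t using that by auto
  \<comment> \<open>Half of \<open>G\<close> is the factor of \<open>(v t)\<^sup>2\<close> in
    \<open>F\<close>. It is nonzero at \<open>1\<close>, so \<open>v\<close> vanishes near
    \<open>1\<close> and then on the connected set \<open>Y\<close>.\<close>
  define G where "G t = \<delta> t + P (W t) / r (W t)" for t
  have "G holomorphic_on Y"
    unfolding G_def P_def by (intro holomorphic_intros holW hol\<delta> holrW) (use rnz in auto)
  then have "open (Y \<inter> G -` (- {0}))"
    by (intro continuous_open_preimage holomorphic_on_imp_continuous_on open_Y) auto
  moreover have "1 \<in> Y \<inter> G -` (- {0})"
  proof -
    have "P 0 = \<delta> 1" by (simp add: P_def \<delta>_1)
    then show ?thesis using \<delta>_1_nonzero by (simp add: G_def)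
  qed
  moreover have "v t = 0" if "t \<in> Y \<inter> G -` (- {0})" for t
    using that F0[of t] by (auto simp: F_def G_def)
  ultimately have "v t = 0"
    by (intro analytic_continuation_open[of "Y \<inter> G -` (- {0})" Y v "\<lambda>_. 0" t])
       (auto intro: open_Y connected_Y holv \<open>t \<in> Y\<close> simp del: Int_iff)
  then show ?thesis by (simp add: v_def)
qed

end

subsection \<open>Extremality implies positive residues\<close>

lemma norm_Moebius_less:
  assumes "norm u < 1" "norm w < 1"
  shows "norm (w - u) < norm (1 - cnj u * w)"
proof -
  have "(norm (1 - cnj u * w))\<^sup>2 - (norm (w - u))\<^sup>2 = (1 - (norm u)\<^sup>2) * (1 - (norm w)\<^sup>2)"
    by (simp only: cmod_power2) (simp add: power2_eq_square algebra_simps)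
  moreover have "0 < (1 - (norm u)\<^sup>2) * (1 - (norm w)\<^sup>2)"
    using assms by (intro mult_pos_pos) (auto simp: power_less_one_iff)
  ultimately show ?thesis
    by (intro power2_less_imp_less[of "norm (w - u)"]) auto
qed

lemma complex_square_nonneg_real:
  assumes "x\<^sup>2 = complex_of_real N" "0 \<le> N"
  shows "Im x = 0"
proof -
  have "x\<^sup>2 = (complex_of_real (sqrt N))\<^sup>2"
    using assms by (simp flip: of_real_power)
  then show ?thesis by (auto simp: power2_eq_iff)
qed

context degree_two
begin

section \<open>Derivatives at the point over infinity\<close>

lemma W_deriv_1: "(W has_field_derivative - ((A1 + A2) / d)) (at 1)"
  using W_has_field_derivative[of 1] by (simp add: \<delta>_1)

text \<open>Differentiate the explicit polynomial \<open>r\<^sup>2\<close> at \<open>0\<close>,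
  where \<open>r\<close> is \<open>1\<close>.\<close>

lemma r_deriv_0: "(r has_field_derivative - cnj ((A1 - A2) / d)) (at 0)"
proof -
  obtain r' where r': "(r has_field_derivative r') (at 0)"
    using holomorphic_derivI[OF r_holomorphic, of 0] open_Collect_less[of norm "\<lambda>_. 1"] that
    by (force intro: continuous_intros)
  then have "((\<lambda>w. (r w)\<^sup>2) has_field_derivative 2 * r') (at 0)"
    by (auto intro!: derivative_eq_intros)
  then have "((\<lambda>w. (1 - cnj w1 * w) * (1 - cnj w2 * w)) has_field_derivative 2 * r') (at 0)"
    by (simp only: r_square)
  moreover have "((\<lambda>w. (1 - cnj w1 * w) * (1 - cnj w2 * w)) has_field_derivative - (cnj w1 + cnj w2)) (at 0)"
    by (auto intro!: derivative_eq_intros)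
  ultimately have "2 * r' = - (cnj w1 + cnj w2)"
    using DERIV_unique by blast
  also have "\<dots> = - cnj (2 * (A1 - A2) / d)"
    unfolding w_sum[symmetric] by simp
  also have "\<dots> = 2 * - cnj ((A1 - A2) / d)" by simp
  finally have "r' = - cnj ((A1 - A2) / d)" by (simp only: mult_cancel_left) simp
  with r' show ?thesis by simp
qed

lemma r_W_deriv_1: "((\<lambda>t. r (W t)) has_field_derivative cnj ((A1 - A2) / d) * ((A1 + A2) / d)) (at 1)"
proof -
  have "(r has_field_derivative - cnj ((A1 - A2) / d)) (at (W 1))"
    using r_deriv_0 by simp
  from DERIV_chain2[OF this W_deriv_1] show ?thesis by simp
qed

lemma \<delta>_deriv_1: "(\<delta> has_field_derivative (A1 - A2) / d) (at 1)"
  using \<delta>_has_field_derivative[of 1] by simp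

lemma norm_sum_less: "norm ((A1 + A2) / d) < 1"
proof -
  have "(norm ((A1 + A2) / d))\<^sup>2 = norm w1 * norm w2"
    by (metis norm_mult norm_power w_prod)
  also have "\<dots> < 1"
    using w1_less w2_less mult_less_cancel_left1[of "norm w1" "norm w2"]
    by (smt (verit, best) mult_left_le norm_ge_zero)
  finally show ?thesis by (simp add: power_less_one_iff abs_square_less_1)
qed

text \<open>Extremality of \<open>W\<close> in the coordinate \<open>t\<close>:
  \<open>- d * deriv g 1\<close> is the derivative at infinity of the function that corresponds to
  \<open>g\<close>.\<close>

definition dominates_competitors :: bool where
  "dominates_competitors \<longleftrightarrow>
     (\<forall>g. g holomorphic_on Y \<and> (\<forall>t\<in>Y. norm (g t) < 1) \<and> g 1 = 0 \<longrightarrow> Re (- d * deriv g 1) \<le> Re (A1 + A2))"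

lemma dominatesD:
  assumes "dominates_competitors" "g holomorphic_on Y" "\<And>t. t \<in> Y \<Longrightarrow> norm (g t) < 1" "g 1 = 0"
    "(g has_field_derivative g') (at 1)"
  shows "Re (- d * g') \<le> Re (A1 + A2)"
  using assms DERIV_imp_deriv unfolding dominates_competitors_def by blast

section \<open>Variations that constrain the residues\<close>

lemma sum_residues_pos:
  assumes "dominates_competitors"
  shows "Im (A1 + A2) = 0" "0 < Re (A1 + A2)"
proof -
  define A where "A = A1 + A2"
  \<comment> \<open>The rotated map has derivative \<open>norm A\<close> at infinity, so extremality
    forces \<open>norm A \<le> Re A\<close>.\<close>
  define \<zeta> where "\<zeta> = (if A = 0 then 1 else cnj A / norm A)"
  have n: "norm \<zeta> = 1" by (simp add: \<zeta>_def norm_divide)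
  have "((\<lambda>t. \<zeta> * W t) has_field_derivative \<zeta> * - (A / d)) (at 1)"
    unfolding A_def by (rule DERIV_cmult[OF W_deriv_1])
  then have "Re (- d * (\<zeta> * - (A / d))) \<le> Re A"
    unfolding A_def
    by (intro dominatesD[OF assms, of "\<lambda>t. \<zeta> * W t"] holomorphic_intros holomorphic_W_Y)
       (auto simp: norm_mult n Y_def)
  moreover have "- d * (\<zeta> * - (A / d)) = norm A"
    by (simp add: \<zeta>_def complex_norm_square[symmetric] power2_eq_square field_simps)
  ultimately have le: "norm A \<le> Re A" by (metis Re_complex_of_real)
  then have "(norm A)\<^sup>2 \<le> (Re A)\<^sup>2" by (intro power_mono) auto
  then have Im: "Im A = 0" by (simp add: cmod_power2)
  obtain B where B: "0 < B" "\<And>t. t \<in> Y \<Longrightarrow> norm t \<le> B"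
    using bounded_Y bounded_pos by metis
  \<comment> \<open>This scales an affine competitor into the disk. Its derivative at infinity is
    positive, which excludes \<open>A = 0\<close>.\<close>
  define \<epsilon> where "\<epsilon> = 1 / (norm d * (B + 2))"
  have "0 < \<epsilon>" using B d by (simp add: \<epsilon>_def)
  have "Re (- d * (- complex_of_real \<epsilon> * cnj d)) \<le> Re A"
    unfolding A_def
  proof (rule dominatesD[OF assms, of "\<lambda>t. - complex_of_real \<epsilon> * cnj d * (t - 1)"])
    show "norm (- complex_of_real \<epsilon> * cnj d * (t - 1)) < 1" if "t \<in> Y" for t
    proof -
      have "norm (t - 1) < B + 2"
        using norm_triangle_ineq4[of t 1] B(2)[OF that] by simp
      then have "\<epsilon> * norm d * norm (t - 1) < \<epsilon> * norm d * (B + 2)"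
        using \<open>0 < \<epsilon>\<close> d by (intro mult_strict_left_mono) auto
      also have "\<dots> = 1" using B d by (simp add: \<epsilon>_def)
      finally show ?thesis using \<open>0 < \<epsilon>\<close> by (simp add: norm_mult)
    qed
  qed (auto intro!: holomorphic_intros derivative_eq_intros)
  moreover have "- d * (- complex_of_real \<epsilon> * cnj d) = complex_of_real (\<epsilon> * (norm d)\<^sup>2)"
    unfolding of_real_mult complex_norm_square by simp
  moreover have "0 < \<epsilon> * (norm d)\<^sup>2" using \<open>0 < \<epsilon>\<close> d by simp
  ultimately have "0 < Re A" by (metis Re_complex_of_real less_le_trans)
  with Im show "Im (A1 + A2) = 0" "0 < Re (A1 + A2)" by (simp_all add: A_def)
qed

lemma r_\<delta>_real_on_frontier:
  assumes "t \<noteq> 0" "norm (W t) = 1"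
  shows "Im (r (W t) * \<delta> t / W t) = 0"
proof (rule complex_square_nonneg_real)
  define w where "w = W t"
  have ww: "w * cnj w = 1" using assms by (simp add: w_def complex_norm_square[symmetric])
  have wnz: "w \<noteq> 0" using assms by (auto simp: w_def)
  have c: "1 - cnj u * w = w * cnj (w - u)" for u
    using ww by (simp add: algebra_simps)
  have "(r w * \<delta> t / w)\<^sup>2 = (w - w1) * (w - w2) * ((1 - cnj w1 * w) * (1 - cnj w2 * w)) / w\<^sup>2"
    using \<delta>_square[OF assms(1)] r_square[of w] by (simp add: power_divide power_mult_distrib w_def)
  also have "\<dots> = ((w - w1) * cnj (w - w1)) * ((w - w2) * cnj (w - w2))"
    unfolding c using wnz by (simp add: power2_eq_square)
  also have "\<dots> = complex_of_real ((norm (w - w1))\<^sup>2 * (norm (w - w2))\<^sup>2)"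
    by (simp only: of_real_mult complex_norm_square)
  finally show "(r (W t) * \<delta> t / W t)\<^sup>2 = complex_of_real ((norm (W t - w1))\<^sup>2 * (norm (W t - w2))\<^sup>2)"
    by (simp add: w_def)
qed simp

text \<open>On the boundary \<open>\<psi> / W\<close> has constant real part \<open>m > 0\<close>: the numbers \<open>\<i> r \<delta> / W\<close> and
  \<open>\<zeta> / W - cnj \<zeta> W\<close> are imaginary there. Hence \<open>W - \<epsilon> \<psi>\<close> is a competitor for small \<open>\<epsilon>\<close>.\<close>

lemma diff_residues_real:
  assumes dom: "dominates_competitors"
  shows "Im (A1 - A2) = 0"
proof (rule ccontr)
  assume nz: "Im (A1 - A2) \<noteq> 0"
  define b where "b = A1 - A2"
  define \<alpha> where "\<alpha> = Re (A1 + A2)"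
  have \<alpha>: "0 < \<alpha>" "A1 + A2 = complex_of_real \<alpha>"
    using sum_residues_pos[OF dom] by (auto simp: \<alpha>_def complex_eq_iff)
  define n where "n = (\<alpha> / norm d)\<^sup>2"
  have "0 \<le> n" "n < 1"
    using norm_sum_less \<alpha> unfolding n_def \<alpha>(2) by (auto simp: norm_divide power_less_one_iff abs_square_less_1)
  \<comment> \<open>The sign makes the first-order gain \<open>(Im b)\<^sup>2 * (1 - n)\<close>
    positive; \<open>m\<close> is chosen so that the term \<open>m * W t\<close> costs exactly half
    of it.\<close>
  define \<kappa> where "\<kappa> = - Im b"
  define m where "m = (Im b)\<^sup>2 * (1 - n) / (2 * \<alpha>)"
  have m: "0 < m" unfolding m_def using nz \<alpha> \<open>n < 1\<close> by (simp add: b_def)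
  \<comment> \<open>Chosen so that \<open>\<psi> 1 = 0\<close>.\<close>
  define \<zeta> where "\<zeta> = - \<i> * \<kappa> * \<delta> 1"
  \<comment> \<open>\<open>C\<close> bounds \<open>\<psi>\<close> on the frontier, where
    \<open>r (W t)\<close> and \<open>\<delta> t\<close> have norm at most \<open>2\<close>. The
    later choice of \<open>\<epsilon>\<close> minimises
    \<open>1 - 2 * \<epsilon> * m + \<epsilon>\<^sup>2 * C\<^sup>2\<close>.\<close>
  define C where "C = 4 * \<bar>\<kappa>\<bar> + 2 * norm \<zeta> + m"
  have "0 < C" unfolding C_def using m by (intro add_nonneg_pos) auto
  define \<epsilon> where "\<epsilon> = m / C\<^sup>2"
  have "0 < \<epsilon>" using m \<open>0 < C\<close> by (simp add: \<epsilon>_def)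
  define \<psi> where "\<psi> t = \<i> * \<kappa> * (r (W t) * \<delta> t) + \<zeta> - cnj \<zeta> * (W t)\<^sup>2 + m * W t" for t
  define g where "g t = W t - \<epsilon> * \<psi> t" for t
  have holg: "g holomorphic_on Y"
    unfolding g_def \<psi>_def by (intro holomorphic_intros holomorphic_W_Y holomorphic_\<delta>_Y holomorphic_r_W)
  have contg: "continuous_on (sublevel 1) g"
  proof -
    have W: "continuous_on (sublevel 1) W" and \<delta>: "continuous_on (sublevel 1) \<delta>"
      by (auto intro: continuous_on_W continuous_on_\<delta>)
    have "continuous_on (sublevel 1) (\<lambda>t. r (W t))"
      by (rule continuous_on_compose2[OF r_continuous W]) (auto simp: sublevel_def)
    then show ?thesis
      unfolding g_def \<psi>_def by (intro continuous_intros W \<delta>)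
  qed
  define B where "B = sqrt (1 - (m / C)\<^sup>2)"
  have "B < 1" using m \<open>0 < C\<close> by (simp add: B_def)
  have frontier: "norm (g t) \<le> B" if "t \<in> frontier Y" for t
  proof -
    have t: "t \<noteq> 0" "norm (W t) = 1" using frontier_Y[OF that] by auto
    define w where "w = W t"
    have ww: "w * cnj w = 1" using t by (simp add: w_def complex_norm_square[symmetric])
    have wnz: "w \<noteq> 0" using t by (auto simp: w_def)
    define \<phi> where "\<phi> = \<psi> t / w"
    have "norm (\<psi> t) \<le> norm (\<i> * \<kappa> * (r w * \<delta> t)) + norm \<zeta> + norm (cnj \<zeta> * w\<^sup>2) + norm (m * w)"
      unfolding \<psi>_def w_def[symmetric]
      by (intro order_trans[OF norm_triangle_ineq] order_trans[OF norm_triangle_ineq4] add_mono order_refl)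
    also have "\<dots> = \<bar>\<kappa>\<bar> * (norm (r w) * norm (\<delta> t)) + norm \<zeta> + norm \<zeta> + m"
      using t m by (simp add: norm_mult norm_power w_def)
    also have "\<dots> \<le> \<bar>\<kappa>\<bar> * (2 * 2) + norm \<zeta> + norm \<zeta> + m"
      using norm_r_le[of w] norm_\<delta>_le[of t] t
      by (intro add_mono mult_left_mono mult_mono order_refl) (auto simp: w_def)
    finally have \<phi>_le: "norm \<phi> \<le> C"
      using t by (simp add: \<phi>_def norm_divide w_def C_def)
    define x where "x = r w * \<delta> t / w"
    have "Im x = 0"
      using r_\<delta>_real_on_frontier[OF t] by (simp add: x_def w_def)
    define y where "y = \<zeta> * cnj w"
    have "1 / w = cnj w" using ww wnz by (simp add: field_simps)
    have "\<phi> = \<i> * \<kappa> * x + (\<zeta> * (1 / w) - cnj \<zeta> * w) + m"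
      using wnz unfolding \<phi>_def \<psi>_def w_def[symmetric] x_def by (simp add: field_simps power2_eq_square)
    also have "\<zeta> * (1 / w) - cnj \<zeta> * w = y - cnj y"
      unfolding \<open>1 / w = cnj w\<close> by (simp add: y_def)
    finally have "Re \<phi> = m"
      using \<open>Im x = 0\<close> by simp
    have g_eq: "g t = w * (1 - \<epsilon> * \<phi>)"
      using wnz by (simp add: g_def \<phi>_def w_def[symmetric] field_simps)
    have "(norm (g t))\<^sup>2 = (norm (1 - \<epsilon> * \<phi>))\<^sup>2"
      using t by (simp add: g_eq norm_mult w_def)
    also have "\<dots> = 1 - 2 * \<epsilon> * m + \<epsilon>\<^sup>2 * (norm \<phi>)\<^sup>2"
      unfolding cmod_power2 using \<open>Re \<phi> = m\<close> by (simp add: power2_eq_square algebra_simps)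
    also have "\<dots> \<le> 1 - 2 * \<epsilon> * m + \<epsilon>\<^sup>2 * C\<^sup>2"
      using \<phi>_le by (intro add_left_mono mult_left_mono power_mono) auto
    also have "\<dots> = 1 - (m / C)\<^sup>2"
      using \<open>0 < C\<close> by (simp add: \<epsilon>_def power2_eq_square field_simps)
    finally show ?thesis
      unfolding B_def by (rule real_le_rsqrt)
  qed
  have less: "norm (g t) < 1" if "t \<in> Y" for t
  proof -
    have "norm (g t) \<le> B"
      by (rule maximum_modulus_frontier[OF _ _ bounded_Y frontier that])
         (auto simp: interior_open open_Y holg intro: continuous_on_subset[OF contg closure_Y_subset])
    then show ?thesis using \<open>B < 1\<close> by simp
  qed
  have g1: "g 1 = 0" by (simp add: g_def \<psi>_def \<zeta>_def)
  define g' where "g' = - ((A1 + A2) / d) - \<epsilon> * (\<i> * \<kappa> * (cnj ((A1 - A2) / d) * ((A1 + A2) / d) * \<delta> 1 + (A1 - A2) / d)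
      + m * - ((A1 + A2) / d))"
  have "(g has_field_derivative g') (at 1)"
    unfolding g_def \<psi>_def g'_def
    by (auto intro!: derivative_eq_intros W_deriv_1 \<delta>_deriv_1 r_W_deriv_1 simp: algebra_simps)
  from dominatesD[OF dom holg less g1 this] have le: "Re (- d * g') \<le> \<alpha>"
    by (simp add: \<alpha>_def)
  have "- d * g' = \<alpha> - \<epsilon> * (- \<i> * \<kappa> * (cnj b * (complex_of_real (\<alpha> * \<alpha>) / (d * cnj d)) + b) + m * \<alpha>)"
    unfolding g'_def \<delta>_1 \<alpha>(2) b_def[symmetric] by (simp add: field_simps)
  also have "complex_of_real (\<alpha> * \<alpha>) / (d * cnj d) = complex_of_real n"
    unfolding n_def by (simp add: power_divide complex_norm_square[symmetric] power2_eq_square)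
  finally have "Re (- d * g') = Re (\<alpha> - \<epsilon> * (- \<i> * \<kappa> * (cnj b * complex_of_real n + b) + m * \<alpha>))"
    by (rule arg_cong)
  also have "\<dots> = \<alpha> + \<epsilon> * ((Im b)\<^sup>2 * (1 - n) - m * \<alpha>)"
    by (simp add: \<kappa>_def power2_eq_square algebra_simps)
  also have "(Im b)\<^sup>2 * (1 - n) - m * \<alpha> = (Im b)\<^sup>2 * (1 - n) / 2"
    using \<alpha>(1) by (simp add: m_def)
  finally have "\<epsilon> * ((Im b)\<^sup>2 * (1 - n) / 2) \<le> 0" using le by simp
  moreover have "0 < \<epsilon> * ((Im b)\<^sup>2 * (1 - n) / 2)"
    using \<open>0 < \<epsilon>\<close> nz \<open>n < 1\<close> by (simp add: b_def)
  ultimately show False by simp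
qed

text \<open>Comparison with \<open>f\<close> and \<open>- f\<close> bounds \<open>a1 - a2\<close>
  and its negative by \<open>a1 + a2\<close>, so neither residue is negative; they are nonzero from
  the start.\<close>

lemma residues_pos:
  assumes dom: "dominates_competitors"
  obtains a1 a2 where "0 < a1" "0 < a2" "A1 = complex_of_real a1" "A2 = complex_of_real a2"
proof -
  define a1 a2 where "a1 = Re A1" and "a2 = Re A2"
  have "Im A1 = 0" "Im A2 = 0"
    using sum_residues_pos(1)[OF dom] diff_residues_real[OF dom] by auto
  then have A: "A1 = complex_of_real a1" "A2 = complex_of_real a2"
    by (auto simp: a1_def a2_def complex_eq_iff)
  define \<beta> where "\<beta> = \<delta> 1"
  \<comment> \<open>A root of the product of the two Blaschke factors with zeros \<open>w1\<close>
    and \<open>w2\<close>, evaluated at \<open>W t\<close>.\<close>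
  define G where "G t = \<delta> t / r (W t)" for t
  define f where "f t = (G t - \<beta>) / (1 - cnj \<beta> * G t)" for t
  have \<beta>: "norm \<beta> < 1" using norm_sum_less by (simp add: \<beta>_def \<delta>_1)
  have G1: "G 1 = \<beta>" by (simp add: G_def \<beta>_def)
  have rnz: "r (W t) \<noteq> 0" if "t \<in> Y" for t
    using that r_nonzero by (auto simp: Y_def)
  have G_less: "norm (G t) < 1" if "t \<in> Y" for t
  proof -
    have t: "t \<noteq> 0" "norm (W t) < 1" using that by (auto simp: Y_def)
    have "(norm (\<delta> t))\<^sup>2 = norm (W t - w1) * norm (W t - w2)"
      using \<delta>_square[OF t(1)] by (metis norm_mult norm_power)
    also have "\<dots> < norm (1 - cnj w1 * W t) * norm (1 - cnj w2 * W t)"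
      by (intro mult_strict_mono' norm_Moebius_less w1_less w2_less t) auto
    also have "\<dots> = (norm (r (W t)))\<^sup>2"
      by (metis norm_mult norm_power r_square)
    finally have "norm (\<delta> t) < norm (r (W t))"
      by (rule power2_less_imp_less) simp
    then show ?thesis using rnz[OF that] by (simp add: G_def norm_divide)
  qed
  have holG: "G holomorphic_on Y"
    unfolding G_def by (intro holomorphic_intros holomorphic_\<delta>_Y holomorphic_r_W rnz)
  have den: "1 - cnj \<beta> * G t \<noteq> 0" if "t \<in> Y" for t
    using norm_Moebius_less[OF \<beta> G_less[OF that]] by auto
  have holf: "f holomorphic_on Y"
    unfolding f_def by (intro holomorphic_intros holG den)
  have f_less: "norm (f t) < 1" if "t \<in> Y" for t
    using norm_Moebius_less[OF \<beta> G_less[OF that]] den[OF that] by (simp add: f_def norm_divide)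
  have f1: "f 1 = 0" by (simp add: f_def G1)
  define G' where "G' = (A1 - A2) / d - \<beta> * (cnj ((A1 - A2) / d) * ((A1 + A2) / d))"
  have G': "(G has_field_derivative G') (at 1)"
    unfolding G_def G'_def
    by (rule DERIV_cong[OF DERIV_divide[OF \<delta>_deriv_1 r_W_deriv_1]]) (simp_all add: \<beta>_def)
  have "(f has_field_derivative G' / (1 - cnj \<beta> * \<beta>)) (at 1)"
    unfolding f_def
    by (rule DERIV_cong[OF DERIV_divide[OF DERIV_diff[OF G' DERIV_const] DERIV_diff[OF DERIV_const DERIV_cmult[OF G']]]])
       (use den[OF one_in_Y] in \<open>simp_all add: G1\<close>)
  \<comment> \<open>For real residues the subtracted term is \<open>cnj \<beta> * \<beta>\<close>
    times \<open>(A1 - A2) / d\<close>, so the denominator of the Moebius derivative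
    cancels.\<close>
  moreover have "G' = (A1 - A2) / d * (1 - cnj \<beta> * \<beta>)"
  proof -
    have \<beta>_eq: "\<beta> = (A1 + A2) / d" by (simp add: \<beta>_def \<delta>_1)
    show ?thesis unfolding G'_def \<beta>_eq unfolding A by (simp add: field_simps)
  qed
  ultimately have f': "(f has_field_derivative (A1 - A2) / d) (at 1)"
    using den[OF one_in_Y] by (simp add: G1)
  have "Re (- d * ((A1 - A2) / d)) \<le> Re (A1 + A2)"
    by (rule dominatesD[OF dom holf f_less f1 f'])
  moreover have "Re (- d * - ((A1 - A2) / d)) \<le> Re (A1 + A2)"
    by (rule dominatesD[OF dom, of "\<lambda>t. - f t"])
       (auto intro: holomorphic_intros holf f_less DERIV_minus f' simp: f1)
  ultimately have "0 \<le> a1" "0 \<le> a2" by (simp_all add: A)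
  moreover have "a1 \<noteq> 0" "a2 \<noteq> 0" using A A1 A2 by auto
  ultimately show ?thesis using that A by simp
qed

end

subsection \<open>Transfer to the sphere\<close>

definition two_pole_map :: "complex \<Rightarrow> complex \<Rightarrow> complex \<Rightarrow> complex \<Rightarrow> csphere \<Rightarrow> csphere" where
  "two_pole_map p1 p2 A1 A2 x = (case x of
      None \<Rightarrow> Some 0
    | Some z \<Rightarrow> if z = p1 \<or> z = p2 then None else Some (A1 / (z - p1) + A2 / (z - p2)))"

locale two_poles = degree_two A1 A2 "p2 - p1" w1 w2
  for A1 A2 p1 p2 w1 w2 :: complex
begin

abbreviation R :: "csphere \<Rightarrow> csphere" where
  "R \<equiv> two_pole_map p1 p2 A1 A2"

definition X :: "csphere set" where
  "X = R -` unit_disk"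

definition tc :: "complex \<Rightarrow> complex" where
  "tc z = (z - p2) / (z - p1)"

definition zc :: "complex \<Rightarrow> complex" where
  "zc t = (p2 - t * p1) / (1 - t)"

text \<open>The point \<open>t = 1\<close> stands for infinity; there \<open>zc\<close> has only the
  default value of a division by zero.\<close>

definition plane_part :: "(csphere \<Rightarrow> complex) \<Rightarrow> complex \<Rightarrow> complex" where
  "plane_part f t = (if t = 1 then f None else f (Some (zc t)))"

definition sphere_part :: "(complex \<Rightarrow> complex) \<Rightarrow> csphere \<Rightarrow> complex" where
  "sphere_part g x = (case x of None \<Rightarrow> g 1 | Some z \<Rightarrow> g (tc z))"

lemma poles_distinct: "p1 \<noteq> p2"
  using d by auto

lemma W_tc:
  assumes "z \<noteq> p1" "z \<noteq> p2"
  shows "W (tc z) = A1 / (z - p1) + A2 / (z - p2)"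
proof -
  have nz: "z - p1 \<noteq> 0" "z - p2 \<noteq> 0" "p2 - p1 \<noteq> 0" using assms poles_distinct by auto
  have "(1 - tc z) = (p2 - p1) / (z - p1)"
    using nz by (simp add: tc_def field_simps)
  moreover have "A1 * (v / u) + A2 = (A1 / u + A2 / v) * v" if "v \<noteq> 0" for u v
    using that by (simp add: distrib_right)
  then have "A1 * tc z + A2 = (A1 / (z - p1) + A2 / (z - p2)) * (z - p2)"
    unfolding tc_def using nz by blast
  moreover have "(p2 - p1) * tc z = (p2 - p1) / (z - p1) * (z - p2)"
    by (simp add: tc_def)
  moreover have "(p2 - p1) / (z - p1) * (c * (z - p2)) / ((p2 - p1) / (z - p1) * (z - p2)) = c" for c
    using nz by simp
  ultimately show ?thesis unfolding W_def by metis
qed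

lemma None_in_X [simp]: "None \<in> X"
  by (simp add: X_def two_pole_map_def unit_disk_def)

lemma Some_in_X: "Some z \<in> X \<longleftrightarrow> z \<noteq> p1 \<and> tc z \<in> Y"
proof (cases "z = p1 \<or> z = p2")
  case True
  then show ?thesis by (auto simp: X_def two_pole_map_def unit_disk_def tc_def Y_def)
next
  case False
  then have "tc z \<noteq> 0" by (simp add: tc_def)
  then show ?thesis
    using False by (auto simp: X_def two_pole_map_def unit_disk_def Y_def W_tc)
qed

lemma zc_minus: "t \<noteq> 1 \<Longrightarrow> zc t - p1 = (p2 - p1) / (1 - t)"
  by (simp add: zc_def field_simps)

lemma tc_zc:
  assumes "t \<noteq> 1"
  shows "zc t \<noteq> p1" "tc (zc t) = t"
proof -
  show "zc t \<noteq> p1" using zc_minus[OF assms] assms d by auto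
  have "zc t - p2 = t * ((p2 - p1) / (1 - t))"
    using assms by (simp add: zc_def field_simps)
  then show "tc (zc t) = t"
    unfolding tc_def zc_minus[OF assms] using assms d by simp
qed

lemma zc_tc:
  assumes "z \<noteq> p1"
  shows "tc z \<noteq> 1" "zc (tc z) = z"
proof -
  have nz: "z - p1 \<noteq> 0" using assms by simp
  show ne: "tc z \<noteq> 1" using nz poles_distinct by (simp add: tc_def)
  have "zc (tc z) - p1 = z - p1"
    unfolding zc_minus[OF ne] using nz d by (simp add: tc_def field_simps)
  then show "zc (tc z) = z" by simp
qed

lemma Some_zc_in_X: "t \<in> Y \<Longrightarrow> t \<noteq> 1 \<Longrightarrow> Some (zc t) \<in> X"
  by (simp add: Some_in_X tc_zc)

lemma the_R: "x \<in> X \<Longrightarrow> the (R x) = sphere_part W x"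
proof (cases x)
  case (Some z)
  assume "x \<in> X"
  then have "z \<noteq> p1" "z \<noteq> p2" using Some by (auto simp: Some_in_X tc_def Y_def)
  then show ?thesis by (simp add: Some two_pole_map_def sphere_part_def W_tc)
qed (simp add: two_pole_map_def sphere_part_def)

lemma plane_part_cong: "(\<And>x. x \<in> X \<Longrightarrow> f x = f' x) \<Longrightarrow> t \<in> Y \<Longrightarrow> plane_part f t = plane_part f' t"
  by (simp add: plane_part_def Some_zc_in_X)

lemma plane_part_sphere_part: "plane_part (sphere_part g) t = g t"
  by (simp add: plane_part_def sphere_part_def tc_zc)

lemma sphere_part_plane_part: "x \<in> X \<Longrightarrow> sphere_part (plane_part f) x = f x"
  by (cases x) (auto simp: plane_part_def sphere_part_def zc_tc Some_in_X)

section \<open>Correspondence of competitors and derivatives\<close>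

lemma Ahlfors_competitor_cong:
  assumes "Ahlfors_competitor X f" "\<And>x. x \<in> X \<Longrightarrow> f x = f' x"
  shows "Ahlfors_competitor X f'"
proof -
  have "(f' \<circ> Some) holomorphic_on (Some -` X)" "(f' \<circ> chart_inf) holomorphic_on (chart_inf -` X)"
    using assms unfolding Ahlfors_competitor_def sphere_holomorphic_on_def
    by (auto elim!: holomorphic_transform)
  moreover have "f' ` X \<subseteq> ball 0 1" "f' None = 0"
    using assms None_in_X unfolding Ahlfors_competitor_def by auto
  ultimately show ?thesis
    unfolding Ahlfors_competitor_def sphere_holomorphic_on_def by blast
qed

lemma holomorphic_tc: "tc holomorphic_on - {p1}"
  unfolding tc_def by (intro holomorphic_intros) auto

lemma holomorphic_zc: "zc holomorphic_on - {1}"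
  unfolding zc_def by (intro holomorphic_intros) auto

lemma competitor_sphere_part:
  assumes hol: "g holomorphic_on Y" and less: "\<And>t. t \<in> Y \<Longrightarrow> norm (g t) < 1" and "g 1 = 0"
  shows "Ahlfors_competitor X (sphere_part g)"
proof -
  have "(g \<circ> tc) holomorphic_on (Some -` X)"
    by (rule holomorphic_on_compose_gen[OF holomorphic_on_subset[OF holomorphic_tc] hol])
       (auto simp: Some_in_X)
  moreover have "g \<circ> tc = sphere_part g \<circ> Some"
    by (auto simp: sphere_part_def)
  ultimately have 1: "(sphere_part g \<circ> Some) holomorphic_on (Some -` X)" by simp
  \<comment> \<open>\<open>tc\<close> read in the coordinate \<open>1 / z\<close> and continued to
    infinity.\<close>
  define T where "T \<zeta> = (1 - p2 * \<zeta>) / (1 - p1 * \<zeta>)" for \<zeta>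
  have T_eq: "T \<zeta> = tc (1 / \<zeta>)" if "\<zeta> \<noteq> 0" for \<zeta>
  proof -
    have "tc (1 / \<zeta>) = ((1 / \<zeta> - p2) * \<zeta>) / ((1 / \<zeta> - p1) * \<zeta>)"
      using that by (simp add: tc_def del: times_divide_eq_left)
    also have "\<dots> = T \<zeta>" using that by (simp add: T_def left_diff_distrib)
    finally show ?thesis by simp
  qed
  have den: "1 - p1 * \<zeta> \<noteq> 0 \<and> T \<zeta> \<in> Y" if "\<zeta> \<in> chart_inf -` X" for \<zeta>
  proof (cases "\<zeta> = 0")
    case True
    then show ?thesis by (simp add: T_def)
  next
    case False
    then have "1 / \<zeta> \<noteq> p1" "tc (1 / \<zeta>) \<in> Y"
      using that by (auto simp: chart_inf_def Some_in_X)
    then show ?thesis using False T_eq by (auto simp: field_simps)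
  qed
  have "T holomorphic_on (chart_inf -` X)"
    unfolding T_def using den by (intro holomorphic_intros) auto
  then have "(g \<circ> T) holomorphic_on (chart_inf -` X)"
    by (rule holomorphic_on_compose_gen[OF _ hol]) (use den in auto)
  moreover have "g \<circ> T = sphere_part g \<circ> chart_inf"
    using T_eq by (auto simp: sphere_part_def chart_inf_def fun_eq_iff) (simp add: T_def)
  ultimately have 2: "(sphere_part g \<circ> chart_inf) holomorphic_on (chart_inf -` X)" by simp
  have "sphere_part g x \<in> ball 0 1" if "x \<in> X" for x
    using that less by (cases x) (auto simp: sphere_part_def Some_in_X)
  with 1 2 \<open>g 1 = 0\<close> show ?thesis
    unfolding Ahlfors_competitor_def sphere_holomorphic_on_def by (auto simp: sphere_part_def)
qed

lemma plane_part_competitor: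
  assumes "Ahlfors_competitor X f"
  shows "plane_part f holomorphic_on Y" "\<And>t. t \<in> Y \<Longrightarrow> norm (plane_part f t) < 1" "plane_part f 1 = 0"
proof -
  have f: "(f \<circ> Some) holomorphic_on (Some -` X)" "(f \<circ> chart_inf) holomorphic_on (chart_inf -` X)"
      "f ` X \<subseteq> ball 0 1" "f None = 0"
    using assms by (auto simp: Ahlfors_competitor_def sphere_holomorphic_on_def)
  show "plane_part f 1 = 0" using f by (simp add: plane_part_def)
  show "norm (plane_part f t) < 1" if "t \<in> Y" for t
  proof -
    have "plane_part f t \<in> f ` X"
      using that Some_zc_in_X[OF that] by (auto simp: plane_part_def)
    with f(3) show ?thesis by auto
  qed
  have "((f \<circ> Some) \<circ> zc) holomorphic_on (Y - {1})"
    by (rule holomorphic_on_compose_gen[OF holomorphic_on_subset[OF holomorphic_zc] f(1)])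
       (auto simp: Some_zc_in_X)
  then have 1: "plane_part f holomorphic_on (Y - {1})"
    by (rule holomorphic_transform) (auto simp: plane_part_def)
  \<comment> \<open>\<open>Q\<close> is \<open>1 / zc\<close>, continued across
    \<open>t = 1\<close>. \<open>V\<close> leaves out the point with \<open>zc t = 0\<close>, which
    the finite chart covers.\<close>
  define V where "V = Y \<inter> {t. p2 - p1 * t \<noteq> 0}"
  define Q where "Q t = (1 - t) / (p2 - p1 * t)" for t
  have "open V"
    unfolding V_def by (intro open_Int open_Y open_Collect_neq continuous_intros)
  have chart_Q: "chart_inf (Q t) = (if t = 1 then None else Some (zc t))" if "t \<in> V" for t
    using that by (auto simp: chart_inf_def Q_def V_def zc_def mult.commute)
  have "Q holomorphic_on V"
    unfolding Q_def V_def by (intro holomorphic_intros) auto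
  then have "((f \<circ> chart_inf) \<circ> Q) holomorphic_on V"
    by (rule holomorphic_on_compose_gen[OF _ f(2)]) (auto simp: chart_Q V_def Some_zc_in_X)
  then have 2: "plane_part f holomorphic_on V"
    by (rule holomorphic_transform) (auto simp: plane_part_def chart_Q)
  have "plane_part f holomorphic_on (Y - {1}) \<union> V"
    using 1 2 \<open>open V\<close> open_Y by (intro holomorphic_on_Un) auto
  moreover have "(Y - {1}) \<union> V = Y"
    using poles_distinct by (auto simp: V_def)
  ultimately show "plane_part f holomorphic_on Y" by simp
qed

lemma filterlim_tc: "filterlim tc (at 1) at_infinity"
proof -
  have "filterlim (\<lambda>z. z - p1) at_infinity at_infinity"
    using tendsto_add_filterlim_at_infinity'[OF filterlim_ident tendsto_const[of "- p1"]] by simp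
  then have "((\<lambda>z. (p1 - p2) / (z - p1)) \<longlongrightarrow> 0) at_infinity"
    by (rule tendsto_divide_0[OF tendsto_const])
  then have "((\<lambda>z. 1 + (p1 - p2) / (z - p1)) \<longlongrightarrow> 1 + 0) at_infinity"
    by (intro tendsto_intros)
  moreover have ev: "\<forall>\<^sub>F z in at_infinity. z \<noteq> p1"
    by (rule eventually_at_infinityI[of "norm p1 + 1"]) auto
  moreover have "\<forall>\<^sub>F z in at_infinity. 1 + (p1 - p2) / (z - p1) = tc z"
    using ev by eventually_elim (simp add: tc_def field_simps)
  ultimately have "(tc \<longlongrightarrow> 1) at_infinity"
    using Lim_transform_eventually by fastforce
  moreover have "\<forall>\<^sub>F z in at_infinity. tc z \<noteq> 1"
    using ev by eventually_elim (simp add: zc_tc)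
  ultimately show ?thesis by (simp add: filterlim_at)
qed

text \<open>\<open>tc z - 1\<close> is \<open>- (p2 - p1) / (z - p1)\<close>, so multiplying by
  \<open>z\<close> amounts to dividing by \<open>tc z - 1\<close>, up to the constant and a factor
  tending to \<open>1\<close>.\<close>

lemma deriv_at_inf_eq:
  assumes "Ahlfors_competitor X f"
  shows "deriv_at_inf f = - (p2 - p1) * deriv (plane_part f) 1"
proof -
  define g where "g = plane_part f"
  have "(g has_field_derivative deriv g 1) (at 1)"
    using plane_part_competitor(1)[OF assms] open_Y holomorphic_derivI one_in_Y unfolding g_def by blast
  then have "((\<lambda>t. (g t - g 1) / (t - 1)) \<longlongrightarrow> deriv g 1) (at 1)"
    by (simp add: has_field_derivative_iff)
  then have quot: "((\<lambda>z. (g (tc z) - g 1) / (tc z - 1)) \<longlongrightarrow> deriv g 1) at_infinity"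
    using filterlim_tc filterlim_compose by blast
  have "filterlim (\<lambda>z. z - p1) at_infinity at_infinity"
    using tendsto_add_filterlim_at_infinity'[OF filterlim_ident tendsto_const[of "- p1"]] by simp
  then have "((\<lambda>z. p1 / (z - p1)) \<longlongrightarrow> 0) at_infinity"
    by (rule tendsto_divide_0[OF tendsto_const])
  then have "((\<lambda>z. - (p2 - p1) * (1 + p1 / (z - p1)) * ((g (tc z) - g 1) / (tc z - 1))) \<longlongrightarrow>
      - (p2 - p1) * (1 + 0) * deriv g 1) at_infinity"
    by (intro tendsto_intros quot)
  moreover have "\<forall>\<^sub>F z in at_infinity. - (p2 - p1) * (1 + p1 / (z - p1)) * ((g (tc z) - g 1) / (tc z - 1)) =
      z * (f (Some z) - f None)"
  proof -
    have "\<forall>\<^sub>F z in at_infinity. z \<noteq> p1"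
      by (rule eventually_at_infinityI[of "norm p1 + 1"]) auto
    then show ?thesis
    proof eventually_elim
      case (elim z)
      have "g (tc z) = f (Some z)" "g 1 = f None"
        using zc_tc[OF elim] by (simp_all add: g_def plane_part_def)
      moreover have "tc z - 1 = - (p2 - p1) / (z - p1)" "1 + p1 / (z - p1) = z / (z - p1)"
        using elim by (simp_all add: tc_def field_simps)
      moreover have "- e * (z / u) * (c / (- e / u)) = z * c" if "e \<noteq> 0" "u \<noteq> 0" for c e u
        using that by (simp add: field_simps)
      then have "- (p2 - p1) * (z / (z - p1)) * (c / (- (p2 - p1) / (z - p1))) = z * c" for c
        using elim d by (simp only: right_minus_eq not_False_eq_True)
      ultimately show ?case by (simp only:)
    qed
  qed
  ultimately have "((\<lambda>z. z * (f (Some z) - f None)) \<longlongrightarrow> - (p2 - p1) * (1 + 0) * deriv g 1) at_infinity"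
    by (rule Lim_transform_eventually)
  then show ?thesis
    using tendsto_Lim[OF trivial_limit_at_infinity] unfolding deriv_at_inf_def g_def by fastforce
qed

lemma competitor_R: "Ahlfors_competitor X (the \<circ> R)"
  by (rule Ahlfors_competitor_cong[OF competitor_sphere_part[OF holomorphic_W_Y]])
     (auto simp: Y_def the_R)

lemma deriv_cong_Y:
  assumes "\<And>t. t \<in> Y \<Longrightarrow> f t = g t"
  shows "deriv f 1 = deriv g 1"
proof (rule deriv_cong_ev)
  show "\<forall>\<^sub>F t in nhds 1. f t = g t"
    using eventually_nhds_in_open[OF open_Y one_in_Y] by eventually_elim (use assms in auto)
qed simp

lemma deriv_at_inf_R: "deriv_at_inf (the \<circ> R) = A1 + A2"
proof -
  have "plane_part (the \<circ> R) t = W t" if "t \<in> Y" for t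
    using plane_part_cong[of "the \<circ> R" "sphere_part W" t] that by (simp add: the_R plane_part_sphere_part)
  then have "deriv (plane_part (the \<circ> R)) 1 = deriv W 1"
    by (rule deriv_cong_Y)
  also have "\<dots> = - ((A1 + A2) / (p2 - p1))"
    using W_deriv_1 DERIV_imp_deriv by blast
  finally show ?thesis
    unfolding deriv_at_inf_eq[OF competitor_R]
    by (simp only: minus_mult_minus times_divide_eq_right nonzero_mult_div_cancel_left[OF d])
qed

lemma Ahlfors_maximizer_imp_dominates:
  assumes "Ahlfors_maximizer X (the \<circ> R)"
  shows "dominates_competitors"
  unfolding dominates_competitors_def
proof (intro allI impI, elim conjE)
  fix g assume g: "g holomorphic_on Y" "\<forall>t\<in>Y. norm (g t) < 1" "g 1 = 0"
  then have comp: "Ahlfors_competitor X (sphere_part g)"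
    by (intro competitor_sphere_part) auto
  then have "Re (deriv_at_inf (sphere_part g)) \<le> Re (deriv_at_inf (the \<circ> R))"
    using assms by (auto simp: Ahlfors_maximizer_def)
  moreover have "plane_part (sphere_part g) = g"
    by (rule ext) (rule plane_part_sphere_part)
  ultimately show "Re (- (p2 - p1) * deriv g 1) \<le> Re (A1 + A2)"
    unfolding deriv_at_inf_R deriv_at_inf_eq[OF comp] by simp
qed

section \<open>The complement and its components\<close>

definition E :: "complex set" where
  "E = {z. Some z \<notin> X}"

lemma X_eq: "X = - Some ` E"
proof (rule set_eqI)
  show "x \<in> X \<longleftrightarrow> x \<in> - Some ` E" for x
    by (cases x) (auto simp: E_def)
qed

lemma vimage_Compl_unit_disk: "R -` (- unit_disk) = Some ` E"
  using X_eq unfolding X_def by (simp add: vimage_Compl)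

definition num :: "complex \<Rightarrow> complex" where
  "num z = A1 * (z - p2) + A2 * (z - p1)"

definition den :: "complex \<Rightarrow> complex" where
  "den z = (z - p1) * (z - p2)"

text \<open>The form without division covers the poles and makes \<open>E\<close> visibly
  closed.\<close>

lemma E_iff: "z \<in> E \<longleftrightarrow> norm (den z) \<le> norm (num z)"
proof (cases "z = p1 \<or> z = p2")
  case True
  then show ?thesis by (auto simp: E_def X_def den_def two_pole_map_def unit_disk_def)
next
  case False
  then have "A1 / (z - p1) + A2 / (z - p2) = num z / den z"
    by (simp add: num_def den_def field_simps)
  then have "Some z \<in> X \<longleftrightarrow> norm (num z / den z) < 1"
    using False by (auto simp: X_def two_pole_map_def unit_disk_def)
  moreover have "den z \<noteq> 0" using False by (simp add: den_def)
  ultimately show ?thesis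
    by (auto simp: E_def norm_divide field_simps not_less)
qed

lemma compact_E: "compact E"
proof -
  have "closed {z. norm (den z) \<le> norm (num z)}"
    unfolding den_def num_def by (intro closed_Collect_le continuous_intros)
  moreover have "E = {z. norm (den z) \<le> norm (num z)}"
    using E_iff by blast
  moreover have "bounded E"
  proof -
    have "\<forall>\<^sub>F t in at 1. t \<in> Y"
      using open_Y by (intro eventually_at_in_open') auto
    then have "\<forall>\<^sub>F z in at_infinity. tc z \<in> Y"
      using filterlim_tc by (auto simp: filterlim_iff)
    moreover have "\<forall>\<^sub>F z in at_infinity. z \<noteq> p1"
      by (rule eventually_at_infinityI[of "norm p1 + 1"]) auto
    ultimately have "\<forall>\<^sub>F z in at_infinity. z \<notin> E"
      by eventually_elim (simp add: E_def Some_in_X)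
    then obtain B where "\<And>z. B \<le> norm z \<Longrightarrow> z \<notin> E"
      by (auto simp: eventually_at_infinity)
    then show ?thesis
      unfolding bounded_iff by (metis linorder_not_le order_less_imp_le)
  qed
  ultimately show ?thesis by (simp add: compact_eq_bounded_closed)
qed

lemma connected_Compl_E: "connected (- E)"
proof -
  have "- E = zc ` (Y - {1})"
  proof (intro equalityI subsetI)
    fix z assume "z \<in> - E"
    then have "z \<noteq> p1" "tc z \<in> Y" by (auto simp: E_def Some_in_X)
    then show "z \<in> zc ` (Y - {1})" using zc_tc by (metis DiffI imageI singletonD)
  qed (use Some_zc_in_X in \<open>auto simp: E_def\<close>)
  moreover have "connected (Y - {1})"
    using connected_open_delete[OF open_Y connected_Y] by simp
  moreover have "continuous_on (Y - {1}) zc"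
    by (rule continuous_on_subset[OF holomorphic_on_imp_continuous_on[OF holomorphic_zc]]) auto
  ultimately show ?thesis
    using connected_continuous_image by metis
qed

lemma openin_X: "openin riemann_sphere X"
  unfolding X_eq by (rule openin_riemann_sphere_Compl_Some[OF compact_E])

lemma connectedin_X: "connectedin riemann_sphere X"
  unfolding X_eq by (rule connectedin_riemann_sphere_Compl_Some[OF compact_E connected_Compl_E])

text \<open>The two sheets of the inverse of \<open>den / num = 1 / R\<close> over the closed unit disk, by the quadratic
  formula.\<close>

definition disc_root :: "complex \<Rightarrow> complex" where
  "disc_root y = cnj (r (cnj y))"

definition branch :: "complex \<Rightarrow> complex \<Rightarrow> complex" where
  "branch \<epsilon> y = (p1 + p2 + y * (A1 + A2) + \<epsilon> * ((p2 - p1) * disc_root y)) / 2"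

lemma disc_root_nonzero: "norm y \<le> 1 \<Longrightarrow> disc_root y \<noteq> 0"
  using r_nonzero[of "cnj y"] by (simp add: disc_root_def)

text \<open>The right side is the discriminant of \<open>den z = y * num z\<close> as a quadratic in
  \<open>z\<close>. The conjugations in \<open>disc_root\<close> turn the factors of
  \<open>r\<^sup>2\<close> into \<open>1 - w1 * y\<close> and \<open>1 - w2 * y\<close>.\<close>

lemma disc_root_square:
  "((p2 - p1) * disc_root y)\<^sup>2 = (p2 - p1)\<^sup>2 - 2 * (p2 - p1) * (A1 - A2) * y + (A1 + A2)\<^sup>2 * y\<^sup>2"
proof -
  have "(disc_root y)\<^sup>2 = (1 - w1 * y) * (1 - w2 * y)"
    by (simp add: disc_root_def r_square flip: complex_cnj_power)
  also have "\<dots> = 1 - (w1 + w2) * y + (w1 * w2) * y\<^sup>2"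
    by (simp add: power2_eq_square algebra_simps)
  finally have "(disc_root y)\<^sup>2 = 1 - 2 * (A1 - A2) / (p2 - p1) * y + (A1 + A2)\<^sup>2 / (p2 - p1)\<^sup>2 * y\<^sup>2"
    unfolding w_sum w_prod power_divide .
  moreover have "(p2 - p1)\<^sup>2 * (1 - 2 * (A1 - A2) / (p2 - p1) * y + (A1 + A2)\<^sup>2 / (p2 - p1)\<^sup>2 * y\<^sup>2) =
      (p2 - p1)\<^sup>2 - 2 * (p2 - p1) * (A1 - A2) * y + (A1 + A2)\<^sup>2 * y\<^sup>2"
  proof -
    have "e\<^sup>2 * (1 - 2 * c / e * y + a / e\<^sup>2 * y\<^sup>2) = e\<^sup>2 - 2 * e * c * y + a * y\<^sup>2" if "e \<noteq> 0" for e c a :: complex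
      using that by (simp add: power2_eq_square field_simps)
    from this[OF d] show ?thesis .
  qed
  ultimately show ?thesis by (simp add: power_mult_distrib)
qed

lemma den_minus_num: "den z - y * num z = (z - branch 1 y) * (z - branch (- 1) y)"
proof -
  have "4 * ((z - branch 1 y) * (z - branch (- 1) y)) =
      (2 * z - (p1 + p2 + y * (A1 + A2)))\<^sup>2 - ((p2 - p1) * disc_root y)\<^sup>2"
    unfolding branch_def power2_eq_square by (simp add: field_simps)
  also have "\<dots> = 4 * (den z - y * num z)"
    unfolding disc_root_square den_def num_def by algebra
  finally show ?thesis by (metis mult_left_cancel zero_neq_numeral)
qed

lemma num_nonzero: "z \<in> E \<Longrightarrow> num z \<noteq> 0"
  using d by (auto simp: E_iff den_def num_def)

lemma E_eq: "E = branch 1 ` cball 0 1 \<union> branch (- 1) ` cball 0 1"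
proof (intro equalityI subsetI)
  fix z assume "z \<in> E"
  then have nz: "num z \<noteq> 0" and le: "norm (den z) \<le> norm (num z)"
    using num_nonzero E_iff by auto
  define y where "y = den z / num z"
  have "y \<in> cball 0 1" using nz le by (simp add: y_def norm_divide)
  moreover have "den z - y * num z = 0" using nz by (simp add: y_def)
  then have "z = branch 1 y \<or> z = branch (- 1) y"
    unfolding den_minus_num by auto
  ultimately show "z \<in> branch 1 ` cball 0 1 \<union> branch (- 1) ` cball 0 1" by blast
next
  fix z assume "z \<in> branch 1 ` cball 0 1 \<union> branch (- 1) ` cball 0 1"
  then obtain y where y: "norm y \<le> 1" "z = branch 1 y \<or> z = branch (- 1) y" by auto
  then have "den z = y * num z"
    using den_minus_num[of z y] by auto
  then show "z \<in> E"
    using y by (simp add: E_iff norm_mult mult_left_le_one_le)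
qed

text \<open>A point \<open>z\<close> of \<open>E\<close> determines \<open>y\<close> as
  \<open>den z / num z\<close>, so the sheets could meet only over the same \<open>y\<close>, where
  they differ by a nonzero multiple of \<open>disc_root y\<close>.\<close>

lemma branches_disjoint: "branch 1 ` cball 0 1 \<inter> branch (- 1) ` cball 0 1 = {}"
proof (rule ccontr)
  assume "\<not> ?thesis"
  then obtain y y' where y: "norm y \<le> 1" "norm y' \<le> 1" "branch 1 y = branch (- 1) y'" by force
  define z where "z = branch 1 y"
  have "den z = y * num z" "den z = y' * num z"
    using den_minus_num[of z y] den_minus_num[of z y'] y(3) by (auto simp: z_def)
  moreover have "num z \<noteq> 0"
    using num_nonzero[of z] E_eq y(1) by (auto simp: z_def)
  ultimately have "y = y'" by simp
  have "(x + 1 * e) / 2 - (x + (- 1) * e) / 2 = e" for x e :: complex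
    by (simp add: field_simps)
  then have "branch 1 y - branch (- 1) y = (p2 - p1) * disc_root y"
    unfolding branch_def .
  then have "(p2 - p1) * disc_root y = 0"
    using y(3) \<open>y = y'\<close> by simp
  then show False using disc_root_nonzero[OF y(1)] d by simp
qed

lemma continuous_on_branch: "continuous_on (cball 0 1) (branch \<epsilon>)"
proof -
  have "continuous_on (cball 0 1) (\<lambda>y. r (cnj y))"
    by (rule continuous_on_compose2[OF r_continuous]) (auto intro: continuous_intros)
  then show ?thesis
    unfolding branch_def disc_root_def by (intro continuous_intros) auto
qed

lemma components_complement:
  "card (connected_components_of (subtopology riemann_sphere (R -` (- unit_disk)))) = 2"
proof -
  have "connected_components_of (top_of_set E) = {branch 1 ` cball 0 1, branch (- 1) ` cball 0 1}"
    unfolding E_eq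
    by (intro connected_components_of_Un_disjoint branches_disjoint compact_continuous_image
        connected_continuous_image continuous_on_branch compact_cball connected_cball) auto
  moreover have "branch 1 ` cball 0 1 \<noteq> branch (- 1) ` cball 0 1"
    using branches_disjoint by fastforce
  ultimately have "card (connected_components_of (top_of_set E)) = 2" by simp
  then show ?thesis
    unfolding vimage_Compl_unit_disk using bij_betw_components_Some_image bij_betw_same_card by metis
qed

lemma n_good_R:
  assumes "rational_map_of_degree 2 R"
  shows "n_good 2 R"
  unfolding n_good_def
proof (intro conjI)
  show "R None = Some 0" by (simp add: two_pole_map_def)
  show "finite (connected_components_of (subtopology riemann_sphere (R -` (- unit_disk))))"
    using components_complement by (intro card_ge_0_finite) simp
qed (use assms components_complement connectedin_X in \<open>auto simp: X_def\<close>)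

end

locale two_poles_positive =
  two_poles "complex_of_real a1" "complex_of_real a2" p1 p2 w1 w2 +
  degree_two_positive a1 a2 "p2 - p1" w1 w2
  for a1 a2 :: real and p1 p2 w1 w2 :: complex
begin

lemma norm_deriv_at_inf_le:
  assumes "Ahlfors_competitor X f"
  shows "norm (deriv_at_inf f) \<le> a1 + a2"
proof -
  have "norm (deriv (plane_part f) 1) \<le> norm (deriv W 1)"
    using plane_part_competitor[OF assms] by (intro norm_deriv_le) (auto intro: less_imp_le)
  also have "\<dots> = (a1 + a2) / norm (p2 - p1)"
    unfolding deriv_W_1 \<delta>_1 using a1_pos a2_pos by (simp add: norm_divide flip: of_real_add)
  finally have "norm (p2 - p1) * norm (deriv (plane_part f) 1) \<le> norm (p2 - p1) * ((a1 + a2) / norm (p2 - p1))"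
    by (rule mult_left_mono) simp
  also have "\<dots> = a1 + a2"
    using d by simp
  finally show ?thesis
    unfolding deriv_at_inf_eq[OF assms] norm_mult norm_minus_cancel .
qed

lemma is_Ahlfors_function_R: "is_Ahlfors_function X (the \<circ> R)"
  unfolding is_Ahlfors_function_def
proof (intro conjI allI impI ballI)
  have Re_R: "Re (deriv_at_inf (the \<circ> R)) = a1 + a2"
    by (simp add: deriv_at_inf_R)
  show "Ahlfors_maximizer X (the \<circ> R)"
    unfolding Ahlfors_maximizer_def Re_R
    using competitor_R norm_deriv_at_inf_le complex_Re_le_cmod order_trans by blast
  fix f x assume f: "Ahlfors_maximizer X f" and x: "x \<in> X"
  then have comp: "Ahlfors_competitor X f" and ge: "a1 + a2 \<le> Re (deriv_at_inf f)"
    using competitor_R Re_R by (auto simp: Ahlfors_maximizer_def)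
  have le: "norm (deriv_at_inf f) \<le> a1 + a2"
    by (rule norm_deriv_at_inf_le[OF comp])
  then have Re_f: "Re (deriv_at_inf f) = a1 + a2"
    using ge complex_Re_le_cmod[of "deriv_at_inf f"] by linarith
  \<comment> \<open>The real part already exhausts the modulus, so the imaginary part vanishes and
    the whole derivative is known.\<close>
  moreover have "(norm (deriv_at_inf f))\<^sup>2 \<le> (a1 + a2)\<^sup>2"
    using le by (intro power_mono) auto
  ultimately have "deriv_at_inf f = complex_of_real (a1 + a2)"
    by (simp add: cmod_power2 complex_eq_iff)
  then have "- (p2 - p1) * deriv (plane_part f) 1 = complex_of_real (a1 + a2)"
    by (simp only: deriv_at_inf_eq[OF comp])
  moreover have "- (p2 - p1) * deriv W 1 = complex_of_real (a1 + a2)"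
    unfolding deriv_W_1 \<delta>_1
    by (simp only: minus_mult_minus times_divide_eq_right nonzero_mult_div_cancel_left[OF d] of_real_add)
  ultimately have "deriv (plane_part f) 1 = deriv W 1"
    using d by (metis (no_types) mult_left_cancel neg_equal_0_iff_equal)
  then have eq: "plane_part f t = W t" if "t \<in> Y" for t
    using plane_part_competitor[OF comp] that by (intro extremal_unique) (auto intro: less_imp_le)
  have "f x = sphere_part (plane_part f) x"
    by (rule sphere_part_plane_part[OF x, symmetric])
  also have "\<dots> = sphere_part W x"
    using x eq by (cases x) (auto simp: sphere_part_def Some_in_X)
  finally show "f x = (the \<circ> R) x"
    by (simp add: the_R[OF x])
qed (use openin_X connectedin_X in auto)

end

subsection \<open>Rational maps of degree two\<close>

lemma poly_two_roots_factor:
  fixes q :: "complex poly"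
  assumes "degree q = 2" "poly q a = 0" "poly q b = 0" "a \<noteq> b"
  shows "q = smult (lead_coeff q) ([:- a, 1:] * [:- b, 1:])"
proof -
  have "q \<noteq> 0" using assms(1) by auto
  obtain q1 where q1: "q = [:- a, 1:] * q1"
    using assms(2) by (auto simp: poly_eq_0_iff_dvd dvd_def)
  then have "poly q1 b = 0" using assms(3,4) by simp
  then obtain q2 where q2: "q1 = [:- b, 1:] * q2"
    by (auto simp: poly_eq_0_iff_dvd dvd_def)
  have q: "q = [:- a, 1:] * ([:- b, 1:] * q2)" using q1 q2 by simp
  then have "q2 \<noteq> 0" using \<open>q \<noteq> 0\<close> by auto
  then have "degree q = 2 + degree q2"
    unfolding q by (simp add: degree_mult_eq del: mult_pCons_left)
  then have "degree q2 = 0" using assms(1) by simp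
  then obtain l where "q2 = [:l:]" using degree_eq_zeroE by blast
  then have *: "q = smult l ([:- a, 1:] * [:- b, 1:])" using q by (simp add: algebra_simps)
  then have "lead_coeff q = l" by (simp add: lead_coeff_mult)
  with * show ?thesis by (simp only:)
qed

lemma Some_in_unit_disk: "Some w \<in> unit_disk \<longleftrightarrow> norm w < 1"
  by (auto simp: unit_disk_def)

context
  fixes p q :: "complex poly"
  assumes cop: "coprime p q" and deg_less: "degree p < degree q"
begin

lemma coprime_no_common_root: "poly p z = 0 \<Longrightarrow> poly q z \<noteq> 0"
  using cop by (metis coprime_poly_0)

lemma vimage_Compl_unit_disk_quotient_map:
  "quotient_map_of p q -` (- unit_disk) = Some ` {z. norm (poly q z) \<le> norm (poly p z)}"
proof (rule set_eqI)
  fix x show "x \<in> quotient_map_of p q -` (- unit_disk) \<longleftrightarrow> x \<in> Some ` {z. norm (poly q z) \<le> norm (poly p z)}"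
  proof (cases x)
    case None
    then show ?thesis using deg_less by (auto simp: Some_in_unit_disk coeff_eq_0)
  next
    case (Some z)
    then show ?thesis
      by (cases "poly q z = 0") (auto simp: Some_in_unit_disk unit_disk_def[THEN eqset_imp_iff, of None]
          norm_divide divide_less_eq not_less)
  qed
qed

lemma compact_quotient_superlevel: "compact {z. norm (poly q z) \<le> norm (poly p z)}"
proof -
  have "((\<lambda>z. poly p z / poly q z) \<longlongrightarrow> 0) at_infinity"
    by (rule poly_divide_tendsto_0_at_infinity[OF deg_less])
  then have "\<forall>\<^sub>F z in at_infinity. norm (poly p z / poly q z) < 1"
    by (rule order_tendstoD(2)[OF tendsto_norm_zero]) simp
  moreover have "\<forall>\<^sub>F z in at_infinity. poly q z \<noteq> 0"
  proof -
    have "finite {z. poly q z = 0}" using deg_less by (intro poly_roots_finite) auto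
    then have "bounded {z. poly q z = 0}" by (rule finite_imp_bounded)
    then obtain B where "\<And>z. poly q z = 0 \<Longrightarrow> norm z \<le> B"
      by (auto simp: bounded_iff)
    then show ?thesis
      by (intro eventually_at_infinityI[of "B + 1"]) fastforce
  qed
  ultimately have "\<forall>\<^sub>F z in at_infinity. \<not> norm (poly q z) \<le> norm (poly p z)"
    by eventually_elim (simp add: norm_divide field_simps)
  then obtain B where B: "\<And>z. B \<le> norm z \<Longrightarrow> \<not> norm (poly q z) \<le> norm (poly p z)"
    by (auto simp: eventually_at_infinity)
  have "bounded {z. norm (poly q z) \<le> norm (poly p z)}"
    unfolding bounded_iff using B by (metis (mono_tags, lifting) linorder_not_le mem_Collect_eq order_less_imp_le)
  moreover have "closed {z. norm (poly q z) \<le> norm (poly p z)}"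
    by (intro closed_Collect_le continuous_intros)
  ultimately show ?thesis by (simp add: compact_eq_bounded_closed)
qed

text \<open>Passing to the reciprocal \<open>q / p\<close> turns the complement of the disk, poles
  included, into the preimage of a closed disk.\<close>

lemma clopen_superlevel_takes_value:
  assumes E: "E = {z. norm (poly q z) \<le> norm (poly p z)}"
    and U: "openin (top_of_set E) U" "closedin (top_of_set E) U" "U \<noteq> {}"
    and y: "norm y \<le> 1"
  shows "\<exists>z\<in>U. poly q z = y * poly p z"
proof -
  define S where "S = {z. poly p z \<noteq> 0}"
  define f where "f z = poly q z / poly p z" for z
  have "open S" unfolding S_def by (intro open_Collect_neq continuous_intros)
  have E': "E = {z \<in> S. norm (f z) \<le> 1}"
  proof (rule set_eqI)
    show "z \<in> E \<longleftrightarrow> z \<in> {z \<in> S. norm (f z) \<le> 1}" for z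
      using coprime_no_common_root[of z]
      by (cases "poly p z = 0") (auto simp: E S_def f_def norm_divide divide_le_eq)
  qed
  have nonconst: "\<not> f constant_on T" if "open T" "T \<subseteq> S" "T \<noteq> {}" for T
  proof
    assume "f constant_on T"
    then obtain c where c: "\<And>z. z \<in> T \<Longrightarrow> f z = c" by (auto simp: constant_on_def)
    have "T \<subseteq> {z. poly (q - smult c p) z = 0}"
      using c \<open>T \<subseteq> S\<close> by (force simp: f_def S_def field_simps)
    moreover have "q - smult c p \<noteq> 0"
      using deg_less degree_smult_le[of c p] by force
    ultimately have "finite T"
      using poly_roots_finite finite_subset by blast
    then show False using that finite_imp_not_open by blast
  qed
  have "f holomorphic_on S"
    unfolding f_def S_def by (intro holomorphic_intros) auto
  then have "f ` U = cball 0 1"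
    using clopen_image_eq_cball[OF _ \<open>open S\<close> nonconst E' _ U] compact_quotient_superlevel E by blast
  then have "y \<in> f ` U" using y by simp
  then obtain z where z: "z \<in> U" "y = f z" by blast
  moreover have "z \<in> S" using openin_imp_subset[OF U(1)] z E' by blast
  ultimately show ?thesis by (intro bexI[of _ z]) (auto simp: f_def S_def)
qed

text \<open>Finitely many components are clopen, so each of the two contains a solution.\<close>

lemma two_components_two_preimages:
  assumes card: "card (connected_components_of (subtopology riemann_sphere (quotient_map_of p q -` (- unit_disk)))) = 2"
    and y: "norm y \<le> 1"
  shows "\<exists>z z'. z \<noteq> z' \<and> poly q z = y * poly p z \<and> poly q z' = y * poly p z'"
proof -
  define E where "E = {z. norm (poly q z) \<le> norm (poly p z)}"
  have card': "card (connected_components_of (top_of_set E)) = 2"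
    using card bij_betw_same_card[OF bij_betw_components_Some_image[of E]]
    unfolding vimage_Compl_unit_disk_quotient_map E_def by simp
  then obtain C C' where C: "connected_components_of (top_of_set E) = {C, C'}" "C \<noteq> C'"
    by (auto simp: card_2_iff)
  then have fin: "finite (connected_components_of (top_of_set E))" by simp
  have in_comp: "C \<in> connected_components_of (top_of_set E)" "C' \<in> connected_components_of (top_of_set E)"
    using C by auto
  have "\<exists>z\<in>U. poly q z = y * poly p z" if "U \<in> connected_components_of (top_of_set E)" for U
    using open_in_finite_connected_components[OF fin that] closedin_connected_components_of[OF that]
      nonempty_connected_components_of[OF that]
    by (intro clopen_superlevel_takes_value[OF E_def _ _ _ y])
  from this[OF in_comp(1)] this[OF in_comp(2)]
  obtain z z' where z: "z \<in> C" "poly q z = y * poly p z" "z' \<in> C'" "poly q z' = y * poly p z'"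
    by blast
  have "C \<inter> C' = {}"
    using connected_components_of_disjoint[OF in_comp] C(2) by (simp add: disjnt_def)
  then have "z \<noteq> z'" using z by auto
  then show ?thesis using z by auto
qed

end

lemma quotient_map_of_two_poles:
  fixes p q :: "complex poly"
  assumes cop: "coprime p q" and "degree p < 2" "degree q = 2"
    and roots: "poly q p1 = 0" "poly q p2 = 0" and "p1 \<noteq> p2"
  obtains A1 A2 where "A1 \<noteq> 0" "A2 \<noteq> 0" "quotient_map_of p q = two_pole_map p1 p2 A1 A2"
    "\<And>z. poly p z = lead_coeff q * (A1 * (z - p2) + A2 * (z - p1))"
    "\<And>z. poly q z = lead_coeff q * ((z - p1) * (z - p2))"
proof -
  define l where "l = lead_coeff q"
  have "q \<noteq> 0" using \<open>degree q = 2\<close> by auto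
  then have "l \<noteq> 0" unfolding l_def by (simp only: leading_coeff_0_iff not_False_eq_True)
  have nz: "p1 - p2 \<noteq> 0" "p2 - p1 \<noteq> 0" using \<open>p1 \<noteq> p2\<close> by auto
  have q: "poly q z = l * ((z - p1) * (z - p2))" for z
    using arg_cong[OF poly_two_roots_factor[OF \<open>degree q = 2\<close> roots \<open>p1 \<noteq> p2\<close>], of "\<lambda>q. poly q z"]
    by (simp add: l_def algebra_simps)
  \<comment> \<open>\<open>A1\<close> and \<open>A2\<close> are the residues of \<open>p / q\<close>
    at its two simple poles.\<close>
  define A1 where "A1 = poly p p1 / (l * (p1 - p2))"
  define A2 where "A2 = poly p p2 / (l * (p2 - p1))"
  have "degree p \<le> 1" using \<open>degree p < 2\<close> by simp
  then obtain c0 c1 where pc: "p = [:c0, c1:]"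
    using degree1_coeffs degree_eq_zeroE by (metis One_nat_def le_Suc_eq le_zero_eq pCons_0_0)
  have p: "poly p z = l * (A1 * (z - p2) + A2 * (z - p1))" for z
  proof -
    have "l * A1 = (c0 + c1 * p1) / (p1 - p2)" "l * A2 = - (c0 + c1 * p2) / (p1 - p2)"
      using \<open>l \<noteq> 0\<close> nz by (simp_all add: A1_def A2_def pc field_simps)
    then have "l * (A1 * (z - p2) + A2 * (z - p1)) = ((c0 + c1 * p1) * (z - p2) - (c0 + c1 * p2) * (z - p1)) / (p1 - p2)"
    proof -
      have "u / D * s + - v / D * t = (u * s - v * t) / D" for u v s t D :: complex
        by (simp add: diff_divide_distrib)
      then show ?thesis
        unfolding distrib_left mult.assoc[symmetric] \<open>l * A1 = _\<close> \<open>l * A2 = _\<close> .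
    qed
    also have "(c0 + c1 * p1) * (z - p2) - (c0 + c1 * p2) * (z - p1) = (c0 + c1 * z) * (p1 - p2)"
      by (simp add: algebra_simps)
    finally show ?thesis using nz by (simp add: pc mult.commute)
  qed
  have "poly p p1 \<noteq> 0" "poly p p2 \<noteq> 0"
    using cop roots by (metis coprime_poly_0)+
  then have A_nz: "A1 \<noteq> 0" "A2 \<noteq> 0"
    using \<open>l \<noteq> 0\<close> nz by (simp_all add: A1_def A2_def)
  have "quotient_map_of p q x = two_pole_map p1 p2 A1 A2 x" for x
  proof (cases x)
    case None
    then show ?thesis
      using \<open>degree p < 2\<close> \<open>degree q = 2\<close> by (simp add: two_pole_map_def coeff_eq_0)
  next
    case (Some z)
    show ?thesis
    proof (cases "z = p1 \<or> z = p2")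
      case True
      then show ?thesis using Some roots by (auto simp: two_pole_map_def)
    next
      case False
      then have "poly p z / poly q z = A1 / (z - p1) + A2 / (z - p2)" "poly q z \<noteq> 0"
        unfolding p q using \<open>l \<noteq> 0\<close> by (simp_all add: add_frac_eq mult_ac)
      then show ?thesis using Some False by (simp add: two_pole_map_def)
    qed
  qed
  then have "quotient_map_of p q = two_pole_map p1 p2 A1 A2" by blast
  with A_nz p q show ?thesis using that unfolding l_def by blast
qed

lemma n_good_2_imp_two_poles:
  assumes "rational_map_of_degree 2 R" and good: "n_good 2 R"
  obtains A1 A2 p1 p2 w1 w2 where "two_poles A1 A2 p1 p2 w1 w2" "R = two_pole_map p1 p2 A1 A2"
proof -
  obtain p q where pq: "q \<noteq> 0" "coprime p q" "2 = max (degree p) (degree q)" and R: "R = quotient_map_of p q"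
    using assms(1) by (auto simp: rational_map_of_degree_def)
  have "R None = Some 0" using good by (simp add: n_good_def)
  then have "degree p \<le> degree q" "coeff p (degree q) = 0"
    using pq(1) unfolding R by (auto split: if_splits)
  then have deg: "degree q = 2" "degree p < 2"
    using pq(3) by (simp, metis (no_types) coeff_0 degree_0 leading_coeff_0_iff max.absorb2 nat_less_le pos2)
  then have less: "degree p < degree q" by simp
  have card: "card (connected_components_of (subtopology riemann_sphere (quotient_map_of p q -` (- unit_disk)))) = 2"
    using good by (simp add: n_good_def R)
  note two = two_components_two_preimages[OF pq(2) less card]
  \<comment> \<open>The value \<open>y = 0\<close> corresponds to the poles.\<close>
  obtain p1 p2 where p12: "p1 \<noteq> p2" "poly q p1 = 0" "poly q p2 = 0"
    using two[of 0] by auto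
  obtain A1 A2 where A: "A1 \<noteq> 0" "A2 \<noteq> 0" and Req: "quotient_map_of p q = two_pole_map p1 p2 A1 A2"
    and p: "\<And>z. poly p z = lead_coeff q * (A1 * (z - p2) + A2 * (z - p1))"
    and q: "\<And>z. poly q z = lead_coeff q * ((z - p1) * (z - p2))"
    using quotient_map_of_two_poles[OF pq(2) deg(2,1) p12(2,3,1)] by metis
  define d where "d = p2 - p1"
  have "d \<noteq> 0" using p12 by (simp add: d_def)
  \<comment> \<open>The expression is the square of the difference of two distinct solutions of
    \<open>q = y p\<close>.\<close>
  have disc: "d\<^sup>2 - 2 * d * (A1 - A2) * y + (A1 + A2)\<^sup>2 * y\<^sup>2 \<noteq> 0" if y: "norm y \<le> 1" for y
  proof -
    obtain z z' where z: "z \<noteq> z'" "poly q z = y * poly p z" "poly q z' = y * poly p z'"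
      using two[OF y] by blast
    then have eq: "(z - p1) * (z - p2) = y * (A1 * (z - p2) + A2 * (z - p1))"
        "(z' - p1) * (z' - p2) = y * (A1 * (z' - p2) + A2 * (z' - p1))"
      using pq(1) unfolding p q by (auto simp: mult.left_commute[of y])
    then have "(z - z') * (z + z' - (p1 + p2) - y * (A1 + A2)) = 0"
      by algebra
    then have "z + z' - (p1 + p2) - y * (A1 + A2) = 0"
      using z(1) by (metis mult_eq_0_iff right_minus_eq)
    then have sum: "z + z' = (p1 + p2) + y * (A1 + A2)"
      by algebra
    have "(z - z')\<^sup>2 = d\<^sup>2 - 2 * d * (A1 - A2) * y + (A1 + A2)\<^sup>2 * y\<^sup>2"
      using eq(1) sum unfolding d_def by algebra
    then show ?thesis using z(1) by (metis eq_iff_diff_eq_0 power_eq_0_iff)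
  qed
  define e where "e = csqrt (((A1 - A2) / d)\<^sup>2 - ((A1 + A2) / d)\<^sup>2)"
  define w1 where "w1 = (A1 - A2) / d + e"
  define w2 where "w2 = (A1 - A2) / d - e"
  have w_sum: "w1 + w2 = 2 * (A1 - A2) / d" by (simp add: w1_def w2_def)
  have "w1 * w2 = ((A1 - A2) / d)\<^sup>2 - e\<^sup>2"
    by (simp add: w1_def w2_def power2_eq_square algebra_simps)
  then have w_prod: "w1 * w2 = ((A1 + A2) / d)\<^sup>2" by (simp add: e_def)
  \<comment> \<open>If \<open>u\<close> lay outside the disk, the discriminant would vanish at
    \<open>y = 1 / u\<close>.\<close>
  have w_less: "norm u < 1" if u: "u = w1 \<or> u = w2" for u
  proof (rule ccontr)
    assume "\<not> norm u < 1"
    then have "1 \<le> norm u" by simp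
    then have "u \<noteq> 0" by auto
    with \<open>1 \<le> norm u\<close> have "norm (1 / u) \<le> 1" by (simp add: norm_divide divide_le_eq)
    have "d\<^sup>2 - 2 * d * (A1 - A2) * y + (A1 + A2)\<^sup>2 * y\<^sup>2 = d\<^sup>2 * (1 - (2 * (A1 - A2) / d) * y + ((A1 + A2) / d)\<^sup>2 * y\<^sup>2)" for y
      using \<open>d \<noteq> 0\<close> by (simp add: power2_eq_square field_simps)
    also have "\<dots> y = d\<^sup>2 * ((1 - w1 * y) * (1 - w2 * y))" for y
      unfolding w_sum[symmetric] w_prod[symmetric] by (simp add: power2_eq_square algebra_simps)
    finally have "d\<^sup>2 * ((1 - w1 * (1 / u)) * (1 - w2 * (1 / u))) \<noteq> 0"
      using disc[OF \<open>norm (1 / u) \<le> 1\<close>] by metis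
    then show False using u \<open>u \<noteq> 0\<close> by auto
  qed
  have "two_poles A1 A2 p1 p2 w1 w2"
    by unfold_locales (use A p12 w_sum w_prod w_less in \<open>auto simp: d_def\<close>)
  then show ?thesis using that R Req by blast
qed

theorem theorem1p4:
  fixes R :: "csphere \<Rightarrow> csphere"
  assumes "rational_map_of_degree 2 R"
  shows "rational_Ahlfors_function 2 R \<longleftrightarrow>
    (\<exists>(p1::complex) (p2::complex) (a1::real) (a2::real).
       p1 \<noteq> p2 \<and> 0 < a1 \<and> 0 < a2 \<and> a1 + a2 < cmod (p1 - p2) \<and>
       R = (\<lambda>x. case x of
              None \<Rightarrow> Some 0
            | Some z \<Rightarrow> if z = p1 \<or> z = p2 then None
                else Some (complex_of_real a1 / (z - p1) + complex_of_real a2 / (z - p2))))"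
proof
  assume "rational_Ahlfors_function 2 R"
  then have good: "n_good 2 R" and ahl: "is_Ahlfors_function (R -` unit_disk) (the \<circ> R)"
    by (auto simp: rational_Ahlfors_function_def)
  obtain A1 A2 p1 p2 w1 w2 where tp: "two_poles A1 A2 p1 p2 w1 w2" and R: "R = two_pole_map p1 p2 A1 A2"
    using n_good_2_imp_two_poles[OF assms good] .
  interpret two_poles A1 A2 p1 p2 w1 w2 by (rule tp)
  have "Ahlfors_maximizer X (the \<circ> two_pole_map p1 p2 A1 A2)"
    using ahl by (simp add: is_Ahlfors_function_def R X_def)
  then have "dominates_competitors" by (rule Ahlfors_maximizer_imp_dominates)
  then obtain a1 a2 where a: "0 < a1" "0 < a2" "A1 = complex_of_real a1" "A2 = complex_of_real a2"
    by (rule residues_pos)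
  have "norm (complex_of_real (a1 + a2)) / norm (p2 - p1) < 1"
    using norm_sum_less a by (simp add: norm_divide)
  then have "a1 + a2 < cmod (p1 - p2)"
    using a poles_distinct unfolding norm_of_real by (simp add: norm_minus_commute field_simps)
  then show "\<exists>(p1::complex) (p2::complex) (a1::real) (a2::real).
       p1 \<noteq> p2 \<and> 0 < a1 \<and> 0 < a2 \<and> a1 + a2 < cmod (p1 - p2) \<and>
       R = (\<lambda>x. case x of
              None \<Rightarrow> Some 0
            | Some z \<Rightarrow> if z = p1 \<or> z = p2 then None
                else Some (complex_of_real a1 / (z - p1) + complex_of_real a2 / (z - p2)))"
    unfolding R two_pole_map_def[abs_def] using a poles_distinct by (intro exI conjI) auto
next
  assume "\<exists>(p1::complex) (p2::complex) (a1::real) (a2::real).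
       p1 \<noteq> p2 \<and> 0 < a1 \<and> 0 < a2 \<and> a1 + a2 < cmod (p1 - p2) \<and>
       R = (\<lambda>x. case x of
              None \<Rightarrow> Some 0
            | Some z \<Rightarrow> if z = p1 \<or> z = p2 then None
                else Some (complex_of_real a1 / (z - p1) + complex_of_real a2 / (z - p2)))"
  then obtain p1 p2 :: complex and a1 a2 :: real where p: "p1 \<noteq> p2" and a: "0 < a1" "0 < a2"
    and less: "a1 + a2 < cmod (p1 - p2)" and R: "R = two_pole_map p1 p2 (complex_of_real a1) (complex_of_real a2)"
    unfolding two_pole_map_def[abs_def] by blast
  \<comment> \<open>The critical values for positive residues are \<open>u 1\<close> and
    \<open>u (- 1)\<close>. Both have modulus \<open>(a1 + a2) / norm (p2 - p1)\<close>, so the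
    inequality on the residues says exactly that they lie in the disk.\<close>
  define u where "u s = (Complex (a1 - a2) (s * (2 * sqrt (a1 * a2)))) / (p2 - p1)" for s
  have norm_u: "norm (u s) < 1" if "s\<^sup>2 = 1" for s
  proof -
    have "(a1 - a2)\<^sup>2 + (s * (2 * sqrt (a1 * a2)))\<^sup>2 = (a1 - a2)\<^sup>2 + 4 * (a1 * a2)"
      using a that by (simp add: power_mult_distrib)
    also have "\<dots> = (a1 + a2)\<^sup>2"
      by (simp add: power2_eq_square algebra_simps)
    finally have "norm (Complex (a1 - a2) (s * (2 * sqrt (a1 * a2)))) = sqrt ((a1 + a2)\<^sup>2)"
      by (simp only: complex_norm)
    also have "\<dots> = a1 + a2" using a by simp
    finally show ?thesis using less a p by (simp add: u_def norm_divide norm_minus_commute)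
  qed
  have u_sum: "u 1 + u (- 1) = 2 * (complex_of_real a1 - complex_of_real a2) / (p2 - p1)"
  proof -
    have "Complex x y + Complex x (- y) = 2 * complex_of_real x" for x y
      by (simp add: complex_eq_iff)
    then show ?thesis
      unfolding u_def add_divide_distrib[symmetric] by simp
  qed
  have "Complex (a1 - a2) (2 * sqrt (a1 * a2)) * Complex (a1 - a2) (- (2 * sqrt (a1 * a2))) =
      (complex_of_real a1 + complex_of_real a2)\<^sup>2"
    using a by (simp add: complex_eq_iff power2_eq_square algebra_simps)
  then have u_prod: "u 1 * u (- 1) = ((complex_of_real a1 + complex_of_real a2) / (p2 - p1))\<^sup>2"
    by (simp add: u_def power_divide power2_eq_square)
  interpret two_poles_positive a1 a2 p1 p2 "u 1" "u (- 1)"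
    by unfold_locales (use a p u_sum u_prod norm_u[of 1] norm_u[of "- 1"] in auto)
  show "rational_Ahlfors_function 2 R"
    unfolding rational_Ahlfors_function_def
    using n_good_R assms is_Ahlfors_function_R unfolding R X_def by blast
qed

end
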